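(* There is a polynomial time algorithm that, given a digraph $D$ of order $n$ with $\ell_{\min}(D)>0$ and a positive integer $k$, either finds an out-branching of $D$ with at most $n-k$ leaves or constructs a tree decomposition of $D$ of width at most $2k-2$.
   Context: Digraphs are finite, without loops or parallel arcs. An out-branching of $D$ is a spanning subgraph that is an oriented tree with exactly one vertex of in-degree zero; leaves are its vertices of out-degree zero. $\ell_{\min}(D)$ is the minimum number of leaves of an out-branching of $D$ ($0$ if none exists). A tree decomposition of a digraph is a tree decomposition of its underlying undirected graph; its width is the maximum bag size minus one. *)

theory Defs
  imports
    "HOL-Computational_Algebra.Polynomial"
    "HOL-Library.Log_Nat"
    "Graph_Theory.Graph_Theory"
begin

section \<open>Out-branchings\<close>

text \<open>
  The library predicate \<open>tree\<close> only excludes directed cycles, so it is not used here.  In the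
  underlying graph \<open>mk_symmetric G\<close> every edge is a pair of opposite arcs; a cycle of the
  underlying undirected graph is a cycle of \<open>mk_symmetric G\<close> with at least three arcs.
\<close>

definition undirected_acyclic :: "('a, 'b) pre_digraph \<Rightarrow> bool" where
  "undirected_acyclic G \<longleftrightarrow>
     \<not> (\<exists>p. pre_digraph.cycle (with_proj (mk_symmetric G)) p \<and> 3 \<le> length p)"

definition undirected_tree :: "('a, 'b) pre_digraph \<Rightarrow> bool" where
  "undirected_tree T \<longleftrightarrow> graph T \<and> Digraph_Component.connected T \<and> undirected_acyclic T"

text \<open>An orientation has at most one of the two possible arcs for each edge.\<close>

definition oriented_tree :: "('a, 'b) pre_digraph \<Rightarrow> bool" where
  "oriented_tree H \<longleftrightarrow>
     digraph H \<and> undirected_tree (with_proj (mk_symmetric H)) \<and>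
     (\<forall>u v. u \<rightarrow>\<^bsub>H\<^esub> v \<longrightarrow> \<not> v \<rightarrow>\<^bsub>H\<^esub> u)"

definition out_branching :: "('a, 'b) pre_digraph \<Rightarrow> ('a, 'b) pre_digraph \<Rightarrow> bool" where
  "out_branching B D \<longleftrightarrow>
     spanning B D \<and> oriented_tree B \<and> (\<exists>!r. r \<in> verts B \<and> in_degree B r = 0)"

definition leaves :: "('a, 'b) pre_digraph \<Rightarrow> 'a set" where
  "leaves B = {v \<in> verts B. out_degree B v = 0}"

definition l_min :: "('a, 'b) pre_digraph \<Rightarrow> nat" where
  "l_min D =
     (if \<exists>B. out_branching B D
      then LEAST l. \<exists>B. out_branching B D \<and> card (leaves B) = l
      else 0)"


section \<open>Tree decompositions\<close>

definition tree_decomposition ::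
  "('a, 'b) pre_digraph \<Rightarrow> ('c, 'd) pre_digraph \<Rightarrow> ('c \<Rightarrow> 'a set) \<Rightarrow> bool" where
  "tree_decomposition G T bag \<longleftrightarrow>
     undirected_tree T \<and>
     (\<Union>t \<in> verts T. bag t) = verts G \<and>
     (\<forall>u v. u \<rightarrow>\<^bsub>G\<^esub> v \<longrightarrow> (\<exists>t \<in> verts T. u \<in> bag t \<and> v \<in> bag t)) \<and>
     (\<forall>v \<in> verts G. Digraph_Component.connected (T \<restriction> {t \<in> verts T. v \<in> bag t}))"

definition digraph_tree_decomposition ::
  "('a, 'b) pre_digraph \<Rightarrow> ('c, 'd) pre_digraph \<Rightarrow> ('c \<Rightarrow> 'a set) \<Rightarrow> bool" where
  "digraph_tree_decomposition D T bag \<longleftrightarrow>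
     tree_decomposition (with_proj (mk_symmetric D)) T bag"

definition width :: "('c, 'd) pre_digraph \<Rightarrow> ('c \<Rightarrow> 'a set) \<Rightarrow> int" where
  "width T bag = int (Max ((\<lambda>t. card (bag t)) ` verts T)) - 1"


section \<open>Machine model\<close>

text \<open>
  A random access machine in structured form.  The memory consists of named arrays of natural
  numbers (a program mentions only finitely many of them), the only arithmetic operations are
  addition and truncated subtraction, and every assignment, test and skip costs one step.
  Expressions are part of the program, so their evaluation is a constant number of machine
  operations.  As there is no multiplication, \<open>t\<close> steps lengthen the binary representations of
  the numbers in memory by at most \<open>O(t)\<close>; hence polynomial time in this unit-cost model is
  polynomial time on Turing machines.
\<close>

datatype expr =
    Const nat
  | Get string expr
  | Plus expr expr
  | Minus expr expr

datatype com =
    Skip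
  | Put string expr expr
  | Seq com com
  | IfNZ expr com com
  | WhileNZ expr com

type_synonym memory = "string \<Rightarrow> nat \<Rightarrow> nat"

primrec val :: "expr \<Rightarrow> memory \<Rightarrow> nat" where
  "val (Const c) s = c"
| "val (Get a e) s = s a (val e s)"
| "val (Plus e f) s = val e s + val f s"
| "val (Minus e f) s = val e s - val f s"

text \<open>\<open>exec c s t s'\<close>: started in \<open>s\<close>, program \<open>c\<close> halts in \<open>s'\<close> after \<open>t\<close> steps.\<close>

inductive exec :: "com \<Rightarrow> memory \<Rightarrow> nat \<Rightarrow> memory \<Rightarrow> bool" where
  Skip: "exec Skip s 1 s"
| Put: "exec (Put a i e) s 1 (s(a := (s a)(val i s := val e s)))"
| Seq: "exec c s t s' \<Longrightarrow> exec d s' t' s'' \<Longrightarrow> exec (Seq c d) s (t + t') s''"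
| IfTrue: "val e s \<noteq> 0 \<Longrightarrow> exec c s t s' \<Longrightarrow> exec (IfNZ e c d) s (1 + t) s'"
| IfFalse: "val e s = 0 \<Longrightarrow> exec d s t s' \<Longrightarrow> exec (IfNZ e c d) s (1 + t) s'"
| WhileFalse: "val e s = 0 \<Longrightarrow> exec (WhileNZ e c) s 1 s"
| WhileTrue: "val e s \<noteq> 0 \<Longrightarrow> exec c s t s' \<Longrightarrow> exec (WhileNZ e c) s' t' s'' \<Longrightarrow>
    exec (WhileNZ e c) s (1 + t + t') s''"

lemma exec_deterministic:
  "exec c s t s' \<Longrightarrow> exec c s u s'' \<Longrightarrow> u = t \<and> s'' = s'"
proof (induction arbitrary: u s'' rule: exec.induct)
  case (Skip s)
  then show ?case by cases simp
next
  case (Put a i e s)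
  then show ?case by cases simp
next
  case (Seq c s t s1 d t' s2)
  from Seq.prems show ?case
  proof cases
    case step: (Seq r m r')
    have "r = t" "m = s1" using Seq.IH(1)[OF step(2)] by simp_all
    then show ?thesis using Seq.IH(2)[of r' s''] step by simp
  qed
next
  case (IfTrue e s c t s1 d)
  from IfTrue.prems show ?case
    by cases (use IfTrue.IH[of "u - 1" s''] IfTrue.hyps in auto)
next
  case (IfFalse e s d t s1 c)
  from IfFalse.prems show ?case
    by cases (use IfFalse.IH[of "u - 1" s''] IfFalse.hyps in auto)
next
  case (WhileFalse e s c)
  from WhileFalse.prems show ?case
    by cases (use WhileFalse.hyps in auto)
next
  case (WhileTrue e s c t s1 t' s2)
  from WhileTrue.prems show ?case
  proof cases
    case WhileFalse
    with WhileTrue.hyps show ?thesis by simp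
  next
    case step: (WhileTrue r m r')
    have "r = t" "m = s1" using WhileTrue.IH(1)[OF step(3)] by simp_all
    then show ?thesis using WhileTrue.IH(2)[of r' s''] step by simp
  qed
qed

text \<open>
  A list is stored in an array with its length in cell \<open>0\<close> and its entries in the cells
  \<open>1, 2, \<dots>\<close>.
\<close>

definition initial :: "nat list \<Rightarrow> memory" where
  "initial xs = (\<lambda>a i. if a = ''in'' \<and> i \<le> length xs then (length xs # xs) ! i else 0)"

definition result :: "memory \<Rightarrow> nat list" where
  "result s = map (\<lambda>i. s ''out'' (Suc i)) [0..<s ''out'' 0]"

text \<open>
  Reading off the output is charged as well, so that no program can produce, merely by setting
  the length cell, an output that is longer than its running time.
\<close>

definition runs :: "com \<Rightarrow> nat list \<Rightarrow> nat list \<Rightarrow> nat \<Rightarrow> bool" where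
  "runs c xs ys t \<longleftrightarrow>
     (\<exists>r s. exec c (initial xs) r s \<and> ys = result s \<and> t = r + length ys)"

text \<open>Each number in the input counts with the length of its binary representation plus one.\<close>

definition input_size :: "nat list \<Rightarrow> nat" where
  "input_size xs = (\<Sum>x\<leftarrow>xs. floorlog 2 x + 1)"


section \<open>Encodings\<close>

text \<open>
  A digraph with vertex set \<open>{..<n}\<close> is given by \<open>n\<close> and its adjacency matrix, row by row; a tree
  decomposition of it over a tree with vertex set \<open>{..<m}\<close> by that tree and the incidence matrix
  of the bags, with one row of length \<open>n\<close> for each bag.
\<close>

definition encode_digraph :: "nat \<Rightarrow> nat pair_pre_digraph \<Rightarrow> nat list" where
  "encode_digraph n G =
     n # concat (map (\<lambda>u. map (\<lambda>v. of_bool ((u, v) \<in> parcs G)) [0..<n]) [0..<n])"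

definition encode_tree_decomposition ::
  "nat \<Rightarrow> nat \<Rightarrow> nat pair_pre_digraph \<Rightarrow> (nat \<Rightarrow> nat set) \<Rightarrow> nat list" where
  "encode_tree_decomposition n m T bag =
     encode_digraph m T @
     concat (map (\<lambda>t. map (\<lambda>v. of_bool (v \<in> bag t)) [0..<n]) [0..<m])"

end

theory Submission
  imports Defs
begin

text \<open>
  Starting from an arbitrary out-branching, look for an arc \<open>u \<rightarrow> v\<close> between two leaves such that the
  parent of \<open>v\<close> has another child, and make \<open>v\<close> a child of \<open>u\<close>.  This keeps all internal vertices internal
  and adds \<open>u\<close> to them.  When no such arc is left, either at least \<open>k\<close> vertices are internal, or the
  at most \<open>k - 1\<close> internal vertices together with the only children, of which there is at most one for each
  internal vertex, form a vertex cover \<open>C\<close> with at most \<open>2 * k - 2\<close> elements.  In the latter case the bags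
  \<open>insert t C\<close> on any tree with vertex set \<open>V\<close> form a tree decomposition; a star is used.
\<close>

section \<open>Trees given by parent functions\<close>

text \<open>The definitions express acyclicity through cycles of a symmetrised digraph, which would
  be painful to maintain while a tree is being rewired. Trees are therefore carried as parent
  functions with a height \<open>h\<close> that strictly increases from parent to child. Moving a
  leaf \<open>v\<close> below \<open>u\<close> then amounts to changing one height: no other vertex
  has \<open>v\<close> as parent. The requirement of a second child keeps the old parent of
  \<open>v\<close> internal. The graph-theoretic notions enter only at the two ends: the
  out-branching given by \<open>l_min\<close> shows that some root reaches every vertex, and the
  final parent function is turned back into an out-branching. As the program does not know that
  root, it tries all of them. A bag adds one vertex to the cover, so it has at most
  \<open>2 * k - 1\<close> elements, which is width \<open>2 * k - 2\<close>. Every loop of the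
  program makes exactly \<open>n\<close> rounds, so the time is bounded by an explicit semiring
  expression in \<open>n\<close>. The same expression, read over polynomials, is the required
  polynomial.\<close>

definition parent_arcs :: "'a set \<Rightarrow> 'a \<Rightarrow> ('a \<Rightarrow> 'a) \<Rightarrow> 'a rel" where
  "parent_arcs V r p = (\<lambda>v. (p v, v)) ` (V - {r})"

lemma mk_symmetric_pair:
  "mk_symmetric (with_proj G) = \<lparr>pverts = pverts G, parcs = parcs G \<union> (parcs G)\<inverse>\<rparr>"
  by (auto simp: mk_symmetric_def)

lemma pcas_nth:
  assumes "pcas u p v" "Suc i < length p"
  shows "snd (p ! i) = fst (p ! Suc i)"
  using assms
proof (induction p arbitrary: u i)
  case (Cons e es)
  show ?case
  proof (cases i)
    case 0
    then show ?thesis using Cons.prems by (cases es) auto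
  next
    case (Suc j)
    then show ?thesis using Cons.IH[of "snd e" j] Cons.prems by auto
  qed
qed simp

lemma pcas_ends:
  assumes "pcas u p v" "p \<noteq> []"
  shows "fst (p ! 0) = u" "snd (p ! (length p - 1)) = v"
proof -
  show "fst (p ! 0) = u" using assms by (cases p) auto
  show "snd (p ! (length p - 1)) = v" using assms
  proof (induction p arbitrary: u)
    case (Cons e es)
    then show ?case by (cases es) auto
  qed simp
qed

text \<open>A vertex of maximal height on a cycle would have its parent as both neighbours.\<close>

lemma no_long_cycle:
  fixes h :: "'a \<Rightarrow> nat"
  assumes arcs: "\<And>a b. (a, b) \<in> parcs G \<Longrightarrow> (a = p b \<and> h a < h b) \<or> (b = p a \<and> h b < h a)"
    and cyc: "pre_digraph.cycle (with_proj G) c" and len: "3 \<le> length c"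
  shows False
proof -
  define N where "N = length c"
  obtain u where w: "set c \<subseteq> parcs G" "pcas u c u" and d: "distinct (tl (pawalk_verts u c))"
    using cyc by (auto simp: pre_digraph.cycle_def pre_digraph.awalk_def cas_with_proj_eq
        awalk_verts_with_proj_eq)
  have c: "c \<noteq> []" using len by auto
  \<comment> \<open>Dropping the start vertex leaves the heads of the arcs, so distinctness becomes
    a statement about positions in \<open>c\<close>.\<close>
  have "tl (pawalk_verts u c) = map snd c"
    using pre_digraph.awalk_verts_conv'[of "with_proj G" u c u] w(2) c
    by (simp add: cas_with_proj_eq awalk_verts_with_proj_eq)
  with d have d: "distinct (map snd c)" by simp
  \<comment> \<open>Cyclic successor and predecessor of a position. They differ because
    \<open>N\<close> is at least 3; on a pair of opposite arcs they would coincide.\<close>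
  define nx where "nx i = (if Suc i < N then Suc i else 0)" for i
  define pv where "pv i = (if i = 0 then N - 1 else i - 1)" for i
  have N: "3 \<le> N" using len by (simp add: N_def)
  have nx: "nx i < N" "pv i < N" "nx i \<noteq> pv i" "nx (pv i) = i" if "i < N" for i
    using that N by (auto simp: nx_def pv_def split: if_splits)
  have step: "snd (c ! i) = fst (c ! nx i)" if "i < N" for i
  proof (cases "Suc i < N")
    case True
    then show ?thesis using pcas_nth[OF w(2), of i] by (simp add: nx_def N_def)
  next
    case False
    then have "i = length c - 1" using that by (simp add: N_def)
    then show ?thesis using False pcas_ends[OF w(2) c] by (simp add: nx_def)
  qed
  define f where "f i = h (snd (c ! i))" for i
  have "finite (f ` {..<N})" "f ` {..<N} \<noteq> {}" using N by (auto simp: lessThan_empty_iff)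
  then obtain i where i: "i < N" and "f i = Max (f ` {..<N})"
    by (metis (no_types, lifting) Max_in imageE lessThan_iff)
  then have max: "f j \<le> f i" if "j < N" for j using that by simp
  have "c ! i \<in> parcs G" "c ! nx i \<in> parcs G" using w(1) i nx[OF i] by (auto simp: N_def)
  then have 1: "(snd (c ! pv i), snd (c ! i)) \<in> parcs G" "(snd (c ! i), snd (c ! nx i)) \<in> parcs G"
    using step[OF i] step[OF nx(2)[OF i]] nx(4)[OF i] by (metis prod.collapse)+
  have "snd (c ! pv i) = p (snd (c ! i))" "snd (c ! nx i) = p (snd (c ! i))"
    using arcs[OF 1(1)] arcs[OF 1(2)] max[OF nx(1)[OF i]] max[OF nx(2)[OF i]]
    by (auto simp: f_def)
  then have "map snd c ! pv i = map snd c ! nx i" using nx[OF i] by (simp add: N_def)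
  then show False using nth_eq_iff_index_eq[OF d, of "pv i" "nx i"] nx[OF i] by (simp add: N_def)
qed

text \<open>Since \<open>h\<close> drops at every parent, each vertex climbs to \<open>r\<close>,
  and symmetry reverses these walks, which gives connectedness. The lemma serves both for underlying
  graphs of out-branchings and for the star.\<close>

lemma undirected_tree_parent_arcs:
  fixes h :: "'a \<Rightarrow> nat"
  assumes V: "finite V" "r \<in> V"
    and p: "\<And>v. v \<in> V \<Longrightarrow> v \<noteq> r \<Longrightarrow> p v \<in> V \<and> h (p v) < h v"
    and E: "E = parent_arcs V r p \<union> (parent_arcs V r p)\<inverse>"
  shows "undirected_tree (with_proj \<lparr>pverts = V, parcs = E\<rparr>)"
proof -
  let ?G = "\<lparr>pverts = V, parcs = E\<rparr>"
  have E': "(a, b) \<in> E \<longleftrightarrow> a \<in> V \<and> b \<in> V \<and> (b \<noteq> r \<and> a = p b \<and> h a < h b \<or> a \<noteq> r \<and> b = p a \<and> h b < h a)"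
    for a b using p by (auto simp: E parent_arcs_def)
  have sub: "E \<subseteq> V \<times> V" using E' by auto
  interpret G: pair_digraph ?G
  proof
    show "finite (parcs ?G)" using sub V(1) by (simp add: finite_subset)
  qed (use E' V in auto)
  have sym: "symmetric (with_proj ?G)"
    unfolding symmetric_def sym_def by (auto simp: E')
  have graph: "graph (with_proj ?G)" by (rule G.graphI[OF sym])
  \<comment> \<open>\<open>E\<close> is symmetric already, so the symmetrisation inside
    \<open>undirected_acyclic\<close> changes nothing.\<close>
  have ms: "mk_symmetric (with_proj ?G) = ?G"
    unfolding mk_symmetric_pair by (auto simp: E')
  have up: "v \<rightarrow>\<^sup>*\<^bsub>with_proj ?G\<^esub> r" if "v \<in> V" for v
    using that
  proof (induction "h v" arbitrary: v rule: less_induct)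
    case less
    show ?case
    proof (cases "v = r")
      case False
      then have "(v, p v) \<in> E" "p v \<rightarrow>\<^sup>*\<^bsub>with_proj ?G\<^esub> r" using p less E' by auto
      then show ?thesis using G.adj_reachable_trans by auto
    qed (use V(2) in auto)
  qed
  have "strongly_connected (with_proj ?G)"
  proof
    show "u \<rightarrow>\<^sup>*\<^bsub>with_proj ?G\<^esub> v" if "u \<in> verts (with_proj ?G)" "v \<in> verts (with_proj ?G)" for u v
      using that up[of u] symmetric_reachable[OF sym up[of v]] by (auto intro: G.reachable_trans)
  qed (use V in auto)
  moreover have "\<not> (pre_digraph.cycle (with_proj ?G) c \<and> 3 \<le> length c)" for c
    using no_long_cycle[of ?G p h c] by (auto simp: E')
  ultimately show ?thesis
    unfolding undirected_tree_def undirected_acyclic_def Digraph_Component.connected_def ms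
    using graph by blast
qed

text \<open>Growth of \<open>h\<close> along arcs rules out opposite arcs, and every vertex other
  than \<open>r\<close> has exactly one in-arc, so \<open>r\<close> is the unique source.\<close>

lemma out_branching_parent_arcs:
  fixes h :: "'a \<Rightarrow> nat"
  assumes D: "digraph (with_proj D)" "pverts D = V" "r \<in> V"
    and p: "\<And>v. v \<in> V \<Longrightarrow> v \<noteq> r \<Longrightarrow> (p v, v) \<in> parcs D \<and> h (p v) < h v"
  shows "out_branching (with_proj \<lparr>pverts = V, parcs = parent_arcs V r p\<rparr>) (with_proj D)"
proof -
  let ?E = "parent_arcs V r p"
  let ?B = "\<lparr>pverts = V, parcs = ?E\<rparr>"
  interpret D: digraph "with_proj D" by fact
  have V: "finite V" using D.finite_verts D(2) by simp
  have pV: "p v \<in> V" if "v \<in> V" "v \<noteq> r" for v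
    using p[OF that] D.tail_in_verts[of "(p v, v)"] D(2) by auto
  have sub: "subgraph (with_proj ?B) (with_proj D)"
  proof (rule subgraphI)
    show "wf_digraph (with_proj ?B)"
      using pV D(3) by unfold_locales (force simp: parent_arcs_def)+
    show "wf_digraph (with_proj D)" by unfold_locales
  qed (use p D(2) in \<open>auto simp: parent_arcs_def\<close>)
  interpret B: digraph "with_proj ?B" by (rule D.digraph_subgraph[OF sub])
  have "undirected_tree (with_proj (mk_symmetric (with_proj ?B)))"
    unfolding mk_symmetric_pair
    using undirected_tree_parent_arcs[OF V D(3), of p h] pV p by simp
  moreover have "\<not> v \<rightarrow>\<^bsub>with_proj ?B\<^esub> u" if "u \<rightarrow>\<^bsub>with_proj ?B\<^esub> v" for u v
  proof
    assume "v \<rightarrow>\<^bsub>with_proj ?B\<^esub> u"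
    then have "h v < h u" using p by (auto simp: parent_arcs_def)
    moreover have "h u < h v" using that p by (auto simp: parent_arcs_def)
    ultimately show False by simp
  qed
  ultimately have "oriented_tree (with_proj ?B)"
    unfolding oriented_tree_def using B.digraph_axioms by blast
  moreover have "in_degree (with_proj ?B) v = 0 \<longleftrightarrow> v = r" if "v \<in> V" for v
  proof -
    have "in_arcs (with_proj ?B) v = (if v = r then {} else {(p v, v)})"
      using that by (auto simp: in_arcs_def parent_arcs_def)
    then show ?thesis by (simp add: in_degree_def)
  qed
  ultimately show ?thesis
    using sub D unfolding out_branching_def spanning_def by auto
qed

text \<open>A directed cycle of \<open>B\<close> would be a pair of opposite arcs or a long
  undirected cycle, so the arcs of \<open>B\<close> are acyclic and, being finite, well-founded.
  Going backwards along in-arcs therefore ends, and it can end only at the source.\<close>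

lemma out_branching_root_reaches:
  assumes D: "digraph (with_proj D)" and B: "out_branching B (with_proj D)"
  obtains r where "r \<in> pverts D" "\<And>v. v \<in> pverts D \<Longrightarrow> (r, v) \<in> (parcs D)\<^sup>*"
proof -
  interpret D: digraph "with_proj D" by fact
  have sub: "subgraph B (with_proj D)" and vB: "verts B = pverts D"
    and ot: "oriented_tree B" and "\<exists>!r. r \<in> verts B \<and> in_degree B r = 0"
    using B by (auto simp: out_branching_def spanning_def)
  then obtain r where r: "r \<in> verts B" and r_unique: "\<And>v. v \<in> verts B \<Longrightarrow> in_degree B v = 0 \<Longrightarrow> v = r"
    by blast
  interpret B: digraph B by (rule D.digraph_subgraph[OF sub])
  have th: "tail B = fst" "head B = snd"
    using sub by (auto simp: subgraph_def compatible_def)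
  have Bp: "B = with_proj \<lparr>pverts = verts B, parcs = arcs B\<rparr>"
    by (simp add: with_proj_def th)
  have ac: "acyclic (arcs B)"
  proof (rule ccontr)
    assume "\<not> acyclic (arcs B)"
    then obtain v where "(v, v) \<in> (arcs B)\<^sup>+" by (auto simp: acyclic_def)
    then have "v \<rightarrow>\<^sup>+\<^bsub>B\<^esub> v" using Bp by (metis pair_pre_digraph.select_convs(2) with_proj_simps(3))
    then obtain w where "B.awalk v w v" "w \<noteq> []" using B.reachable1_awalk by blast
    then obtain c where c: "B.cycle c" using B.closed_w_imp_cycle by (auto simp: B.closed_w_def)
    then obtain u where u: "B.awalk u c u" "distinct (tl (B.awalk_verts u c))" "2 \<le> length c"
      using B.cycle_digraph_conv by blast
    have "length c \<noteq> 2"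
    proof
      assume "length c = 2"
      then obtain e f where ef: "c = [e, f]" by (auto simp: length_Suc_conv numeral_2_eq_2)
      then have "e \<in> arcs B" "f \<in> arcs B" "snd e = fst f" "snd f = fst e"
        using u(1) by (auto simp: B.awalk_def th)
      then have "fst e \<rightarrow>\<^bsub>B\<^esub> snd e" "snd e \<rightarrow>\<^bsub>B\<^esub> fst e"
        using B.in_arcs_imp_in_arcs_ends[of e] B.in_arcs_imp_in_arcs_ends[of f] by (simp_all add: th)
      then show False using ot by (auto simp: oriented_tree_def)
    qed
    then have len: "3 \<le> length c" using u(3) by simp
    \<comment> \<open>One symmetrisation stems from \<open>oriented_tree\<close>, the other from
      \<open>undirected_acyclic\<close>. A cycle of \<open>B\<close> survives in this
      supergraph.\<close>
    let ?S = "with_proj (mk_symmetric (with_proj (mk_symmetric B)))"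
    have "wf_digraph ?S"
      by unfold_locales (use B.wellformed[unfolded th] in \<open>force simp: mk_symmetric_def th\<close>)+
    then have "subgraph B ?S"
      by (intro subgraphI) (auto simp: mk_symmetric_def compatible_def th B.wf_digraph)
    then have "pre_digraph.cycle ?S c"
      using c by (auto intro: wf_digraph.subgraph_cycle)
    then show False using ot len
      by (auto simp: oriented_tree_def undirected_tree_def undirected_acyclic_def)
  qed
  have wf: "wf (arcs B)" using finite_acyclic_wf[OF B.finite_arcs ac] .
  have "(r, v) \<in> (arcs B)\<^sup>*" if "v \<in> verts B" for v
    using wf that
  proof (induction v rule: wf_induct_rule)
    case (less v)
    show ?case
    proof (cases "v = r")
      case False
      then have "in_degree B v \<noteq> 0" using r_unique less.prems by blast
      then have "in_arcs B v \<noteq> {}" by (auto simp: in_degree_def)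
      then obtain e where e: "e \<in> arcs B" "snd e = v" by (auto simp: in_arcs_def th)
      then have "(fst e, v) \<in> arcs B" "fst e \<in> verts B"
        using B.tail_in_verts[OF e(1)] by (auto simp: th)
      with less show ?thesis by (meson rtrancl.rtrancl_into_rtrancl)
    qed simp
  qed
  moreover have "arcs B \<subseteq> parcs D" using sub by (auto simp: subgraph_def)
  ultimately show ?thesis using that[of r] r vB rtrancl_mono by blast
qed

text \<open>A vertex of \<open>C\<close> lies in all bags and any other vertex \<open>v\<close> only
  in bag \<open>v\<close>, so the nodes to be connected are the whole star or a single one. An arc
  has one end in \<open>C\<close>, hence lies in the bag of its other end.\<close>

lemma star_tree_decomposition:
  fixes D :: "nat pair_pre_digraph"
  assumes D: "digraph (with_proj D)" "pverts D = {..<n}" "0 < n"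
    and C: "C \<subseteq> {..<n}" "\<And>u v. (u, v) \<in> parcs D \<Longrightarrow> u \<in> C \<or> v \<in> C"
  shows "digraph_tree_decomposition (with_proj D)
    (with_proj \<lparr>pverts = {..<n}, parcs = {(i, j). i < n \<and> j < n \<and> (i = 0) \<noteq> (j = 0)}\<rparr>)
    (\<lambda>t. insert t C)"
proof -
  interpret D: digraph "with_proj D" by fact
  let ?E = "{(i, j). i < n \<and> j < n \<and> (i = 0) \<noteq> (j = 0)}"
  let ?T = "\<lparr>pverts = {..<n}, parcs = ?E\<rparr>"
  have star: "?E = parent_arcs {..<n} 0 (\<lambda>_. 0) \<union> (parent_arcs {..<n} 0 (\<lambda>_. 0))\<inverse>"
    using D(3) by (auto simp: parent_arcs_def)
  have tree: "undirected_tree (with_proj ?T)"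
    using undirected_tree_parent_arcs[OF _ _ _ star, of id] D(3) by auto
  have "Digraph_Component.connected (with_proj ?T \<restriction> {t \<in> {..<n}. v \<in> insert t C})"
    if "v < n" for v
  proof (cases "v \<in> C")
    case True
    then have "with_proj ?T \<restriction> {t \<in> {..<n}. v \<in> insert t C} = with_proj ?T"
      by (auto simp: induce_subgraph_def with_proj_def)
    then show ?thesis using tree by (simp add: undirected_tree_def)
  next
    case False
    then have "{t \<in> {..<n}. v \<in> insert t C} = {v}" using that by auto
    then show ?thesis
      by (auto simp: Digraph_Component.connected_def strongly_connected_def reachable_def
          induce_subgraph_def)
  qed
  moreover have "\<exists>t\<in>{..<n}. u \<in> insert t C \<and> v \<in> insert t C"
    if "(u, v) \<in> parcs D \<or> (v, u) \<in> parcs D" for u v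
  proof -
    have "u < n" "v < n" using that D.wellformed D(2) by force+
    moreover have "u \<in> C \<or> v \<in> C" using that C(2) by blast
    ultimately show ?thesis by blast
  qed
  moreover have "(\<Union>t\<in>{..<n}. insert t C) = {..<n}" using C(1) D(3) by auto
  ultimately show ?thesis
    using tree D(2)
    unfolding digraph_tree_decomposition_def tree_decomposition_def mk_symmetric_pair
    by simp
qed

section \<open>Weakest preconditions with time bounds\<close>

text \<open>Total correctness, with \<open>T\<close> as an upper bound rather than an exact count,
  so that branches and rounds of different cost can share one budget.\<close>

definition wp :: "com \<Rightarrow> nat \<Rightarrow> (memory \<Rightarrow> bool) \<Rightarrow> memory \<Rightarrow> bool" where
  "wp c T Q s \<longleftrightarrow> (\<exists>t s'. exec c s t s' \<and> t \<le> T \<and> Q s')"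

lemma wp_mono:
  "wp c T Q s \<Longrightarrow> T \<le> T' \<Longrightarrow> (\<And>s. Q s \<Longrightarrow> Q' s) \<Longrightarrow> wp c T' Q' s"
  unfolding wp_def by (meson le_trans)

lemma wp_Skip: "Q s \<Longrightarrow> 1 \<le> T \<Longrightarrow> wp Skip T Q s"
  unfolding wp_def by (meson exec.Skip)

lemma wp_Put: "Q (s(a := (s a)(val i s := val e s))) \<Longrightarrow> 1 \<le> T \<Longrightarrow> wp (Put a i e) T Q s"
  unfolding wp_def by (meson exec.Put)

lemma wp_Seq: "wp c T (wp d U Q) s \<Longrightarrow> wp (Seq c d) (T + U) Q s"
  unfolding wp_def by (meson exec.Seq add_mono)

lemma wp_If:
  "(val e s \<noteq> 0 \<Longrightarrow> wp c T Q s) \<Longrightarrow> (val e s = 0 \<Longrightarrow> wp d T Q s) \<Longrightarrow> wp (IfNZ e c d) (1 + T) Q s"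
  unfolding wp_def by (cases "val e s = 0") (meson exec.IfTrue exec.IfFalse add_le_mono le_refl)+

lemma wp_While_False: "val e s = 0 \<Longrightarrow> Q s \<Longrightarrow> 1 \<le> T \<Longrightarrow> wp (WhileNZ e c) T Q s"
  unfolding wp_def by (meson exec.WhileFalse)

lemma wp_While_True:
  "val e s \<noteq> 0 \<Longrightarrow> wp c T (wp (WhileNZ e c) U Q) s \<Longrightarrow> wp (WhileNZ e c) (1 + T + U) Q s"
  unfolding wp_def by (meson exec.WhileTrue add_mono le_refl)

abbreviation Var :: "string \<Rightarrow> expr" where
  "Var x \<equiv> Get x (Const 0)"

abbreviation Assign :: "string \<Rightarrow> expr \<Rightarrow> com" where
  "Assign x e \<equiv> Put x (Const 0) e"

definition For :: "string \<Rightarrow> com \<Rightarrow> com" where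
  "For x c = Seq (Assign x (Const 0))
     (WhileNZ (Minus (Var ''n'') (Var x)) (Seq c (Assign x (Plus (Var x) (Const 1)))))"

text \<open>Generic, so that it applies to numbers of steps and to the polynomials bounding them.\<close>

definition loop_time :: "'a::comm_semiring_1 \<Rightarrow> 'a \<Rightarrow> 'a" where
  "loop_time n T = n * (T + 2) + 2"

text \<open>A round costs the test, the body and the increment, hence \<open>T + 2\<close>; the
  initial assignment and the failing test make up the remaining 2. The invariant receives the
  counter as an argument and by \<open>frame\<close> must not read it from memory, where it changes
  between rounds.\<close>

lemma wp_For:
  assumes x: "x \<noteq> ''n''"
    and frame: "\<And>j s m. I j s \<Longrightarrow> I j (s(x := (s x)(0 := m)))"
    and body: "\<And>j s. j < n \<Longrightarrow> I j s \<Longrightarrow> s x 0 = j \<Longrightarrow> s ''n'' 0 = n \<Longrightarrow>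
      wp c T (\<lambda>s'. I (Suc j) s' \<and> s' x 0 = j \<and> s' ''n'' 0 = n) s"
    and init: "I 0 s" "s ''n'' 0 = n"
    and final: "\<And>s. I n s \<Longrightarrow> s ''n'' 0 = n \<Longrightarrow> Q s"
  shows "wp (For x c) (loop_time n T) Q s"
proof -
  let ?W = "WhileNZ (Minus (Var ''n'') (Var x)) (Seq c (Assign x (Plus (Var x) (Const 1))))"
  have loop: "wp ?W ((n - j) * (T + 2) + 1) Q s" if "j \<le> n" "I j s" "s x 0 = j" "s ''n'' 0 = n" for j s
    using that
  proof (induction j arbitrary: s rule: inc_induct)
    case base
    then show ?case by (intro wp_While_False final) auto
  next
    case (step j)
    have "wp ?W (1 + (T + 1) + ((n - Suc j) * (T + 2) + 1)) Q s"
    proof (rule wp_While_True)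
      show "wp (Seq c (Assign x (Plus (Var x) (Const 1)))) (T + 1)
          (wp ?W ((n - Suc j) * (T + 2) + 1) Q) s"
      proof (rule wp_Seq, rule wp_mono[OF body[OF step(2,4-6)] le_refl])
        fix s' assume s': "I (Suc j) s' \<and> s' x 0 = j \<and> s' ''n'' 0 = n"
        have "wp ?W ((n - Suc j) * (T + 2) + 1) Q (s'(x := (s' x)(0 := Suc j)))"
          by (rule step.IH[OF frame]) (use s' x in auto)
        then show "wp (Assign x (Plus (Var x) (Const 1))) 1 (wp ?W ((n - Suc j) * (T + 2) + 1) Q) s'"
          by (intro wp_Put) (use s' in simp_all)
      qed
    qed (use step in auto)
    moreover have "n - j = Suc (n - Suc j)" using step.hyps by simp
    ultimately show ?case by (simp add: algebra_simps)
  qed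
  have "wp (For x c) (1 + (n * (T + 2) + 1)) Q s"
    unfolding For_def
    by (intro wp_Seq wp_Put) (use loop[of 0] init frame x in auto)
  then show ?thesis by (simp add: loop_time_def)
qed

text \<open>Meant for invariants about the pairs lexicographically before \<open>(i, j)\<close>:
  \<open>carry\<close> identifies the end of one row with the start of the next.\<close>

lemma wp_For2:
  assumes xy: "x \<noteq> ''n''" "y \<noteq> ''n''" "x \<noteq> y"
    and frame: "\<And>i j s m. I i j s \<Longrightarrow> I i j (s(x := (s x)(0 := m)))"
      "\<And>i j s m. I i j s \<Longrightarrow> I i j (s(y := (s y)(0 := m)))"
    and body: "\<And>i j s. i < n \<Longrightarrow> j < n \<Longrightarrow> I i j s \<Longrightarrow> s x 0 = i \<Longrightarrow> s y 0 = j \<Longrightarrow> s ''n'' 0 = n \<Longrightarrow>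
      wp c T (\<lambda>s'. I i (Suc j) s' \<and> s' x 0 = i \<and> s' y 0 = j \<and> s' ''n'' 0 = n) s"
    and carry: "\<And>i s. i < n \<Longrightarrow> I i n s \<Longrightarrow> I (Suc i) 0 s"
    and init: "I 0 0 s" "s ''n'' 0 = n"
    and final: "\<And>s. I n 0 s \<Longrightarrow> s ''n'' 0 = n \<Longrightarrow> Q s"
  shows "wp (For x (For y c)) (loop_time n (loop_time n T)) Q s"
proof (rule wp_For[where I = "\<lambda>i. I i 0"])
  fix i s assume i: "i < n" "I i 0 s" "s x 0 = i" "s ''n'' 0 = n"
  show "wp (For y c) (loop_time n T) (\<lambda>s'. I (Suc i) 0 s' \<and> s' x 0 = i \<and> s' ''n'' 0 = n) s"
  proof (rule wp_For[where I = "\<lambda>j s. I i j s \<and> s x 0 = i"])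
    fix j s assume "j < n" "I i j s \<and> s x 0 = i" "s y 0 = j" "s ''n'' 0 = n"
    then show "wp c T (\<lambda>s'. (I i (Suc j) s' \<and> s' x 0 = i) \<and> s' y 0 = j \<and> s' ''n'' 0 = n) s"
      using body[of i j s] i(1) by (auto elim: wp_mono)
  qed (use i xy frame carry in auto)
qed (use xy frame init final in auto)

section \<open>Truth values by truncated subtraction\<close>

definition NotE :: "expr \<Rightarrow> expr" where
  "NotE e = Minus (Const 1) e"

definition AndE :: "expr \<Rightarrow> expr \<Rightarrow> expr" where
  "AndE e f = NotE (Plus (NotE e) (NotE f))"

definition NeqE :: "expr \<Rightarrow> expr \<Rightarrow> expr" where
  "NeqE e f = NotE (NotE (Plus (Minus e f) (Minus f e)))"

lemma val_NotE [simp]: "val (NotE e) s = of_bool (val e s = 0)"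
  by (simp add: NotE_def)

lemma val_AndE [simp]: "val (AndE e f) s = of_bool (val e s \<noteq> 0 \<and> val f s \<noteq> 0)"
  by (simp add: AndE_def)

lemma val_NeqE [simp]: "val (NeqE e f) s = of_bool (val e s \<noteq> val f s)"
  by (auto simp: NeqE_def)

section \<open>Matrices as lists and their output\<close>

definition matrix_list :: "nat \<Rightarrow> nat \<Rightarrow> (nat \<Rightarrow> nat \<Rightarrow> 'a) \<Rightarrow> 'a list" where
  "matrix_list m n f = concat (map (\<lambda>u. map (f u) [0..<n]) [0..<m])"

lemma matrix_list_simps [simp]:
  "matrix_list 0 n f = []"
  "matrix_list (Suc m) n f = matrix_list m n f @ map (f m) [0..<n]"
  by (simp_all add: matrix_list_def)

lemma length_matrix_list [simp]: "length (matrix_list m n f) = m * n"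
  by (induction m) auto

lemma nth_matrix_list:
  assumes "u < m" "v < n"
  shows "matrix_list m n f ! (u * n + v) = f u v"
  using assms
proof (induction m)
  case (Suc m)
  show ?case
  proof (cases "u = m")
    case False
    then have "u < m" using Suc.prems by simp
    then have "Suc u * n \<le> m * n" by (intro mult_le_mono1) simp
    then have "u * n + v < m * n" using Suc.prems by simp
    then show ?thesis using Suc False by (simp add: nth_append)
  qed (use Suc.prems in \<open>simp add: nth_append\<close>)
qed simp

lemma matrix_list_cong:
  "(\<And>u v. u < m \<Longrightarrow> v < n \<Longrightarrow> f u v = g u v) \<Longrightarrow> matrix_list m n f = matrix_list m n g"
  by (induction m) auto

definition emit :: "expr \<Rightarrow> com" where
  "emit e = Seq (Assign ''out'' (Plus (Var ''out'') (Const 1))) (Put ''out'' (Var ''out'') e)"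

lemma result_append:
  "result (s(''out'' := (s ''out'')(0 := Suc (s ''out'' 0), Suc (s ''out'' 0) := x))) = result s @ [x]"
  by (auto simp: result_def)

text \<open>The length cell is raised before \<open>e\<close> is evaluated, so the value of
  \<open>e\<close> has to be independent of the array \<open>out\<close>.\<close>

lemma wp_emit:
  assumes "\<And>f. val e (s(''out'' := f)) = x"
    and "\<And>f. result (s(''out'' := f)) = result s @ [x] \<Longrightarrow> Q (s(''out'' := f))"
  shows "wp (emit e) 2 Q s"
proof -
  have "wp (emit e) (1 + 1) Q s"
    unfolding emit_def
    by (intro wp_Seq wp_Put) (use assms result_append in simp_all)
  then show ?thesis by (simp add: numeral_2_eq_2)
qed

definition emit_matrix :: "expr \<Rightarrow> com" where
  "emit_matrix e = For ''u'' (For ''v'' (emit e))"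

text \<open>\<open>K\<close> fixes the part of the memory that \<open>e\<close> reads besides the
  two counters; it must survive the writes of the loop.\<close>

lemma wp_emit_matrix:
  assumes e: "\<And>u v s. u < n \<Longrightarrow> v < n \<Longrightarrow> K s \<Longrightarrow> s ''u'' 0 = u \<Longrightarrow> s ''v'' 0 = v \<Longrightarrow> val e s = f u v"
    and K: "\<And>s x g. x \<in> {''u'', ''v'', ''out''} \<Longrightarrow> K s \<Longrightarrow> K (s(x := g))"
    and init: "K s" "s ''n'' 0 = n"
    and final: "\<And>s'. K s' \<Longrightarrow> s' ''n'' 0 = n \<Longrightarrow> result s' = result s @ matrix_list n n f \<Longrightarrow> Q s'"
  shows "wp (emit_matrix e) (loop_time n (loop_time n 2)) Q s"
  unfolding emit_matrix_def
proof (rule wp_For2[where I = "\<lambda>u v s'. K s' \<and>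
      result s' = result s @ matrix_list u n f @ map (f u) [0..<v]"])
  fix i j s'
  assume *: "i < n" "j < n" "K s' \<and> result s' = result s @ matrix_list i n f @ map (f i) [0..<j]"
    "s' ''u'' 0 = i" "s' ''v'' 0 = j" "s' ''n'' 0 = n"
  show "wp (emit e) 2 (\<lambda>s'. (K s' \<and> result s' = result s @ matrix_list i n f @ map (f i) [0..<Suc j])
      \<and> s' ''u'' 0 = i \<and> s' ''v'' 0 = j \<and> s' ''n'' 0 = n) s'"
    by (rule wp_emit) (use * e[OF *(1,2)] K in auto)
qed (use init final K in \<open>auto simp: result_def\<close>)

section \<open>Parent functions and local improvements\<close>

text \<open>
  In a parent function on \<open>{..<n}\<close> the value \<open>n\<close> marks the root, and larger values mark the vertices
  that the search has not reached.
\<close>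

definition partial_tree :: "nat \<Rightarrow> nat rel \<Rightarrow> nat \<Rightarrow> (nat \<Rightarrow> nat) \<Rightarrow> bool" where
  "partial_tree n A r p \<longleftrightarrow> r < n \<and> p r = n \<and>
     (\<exists>h::nat \<Rightarrow> nat. \<forall>v<n. v \<noteq> r \<and> p v \<le> n \<longrightarrow>
        p v < n \<and> p (p v) \<le> n \<and> (p v, v) \<in> A \<and> h (p v) < h v)"

definition parent_tree :: "nat \<Rightarrow> nat rel \<Rightarrow> nat \<Rightarrow> (nat \<Rightarrow> nat) \<Rightarrow> bool" where
  "parent_tree n A r p \<longleftrightarrow> r < n \<and> p r = n \<and>
     (\<exists>h::nat \<Rightarrow> nat. \<forall>v<n. v \<noteq> r \<longrightarrow> p v < n \<and> (p v, v) \<in> A \<and> h (p v) < h v)"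

text \<open>Parents of reached vertices are reached, so the unreached \<open>v\<close> is nobody's
  parent in the tree and its height may be set to \<open>Suc (h u)\<close>.\<close>

lemma partial_tree_upd:
  assumes t: "partial_tree n A r p" and uv: "u < n" "p u \<le> n" "v < n" "n < p v" "(u, v) \<in> A"
  shows "partial_tree n A r (p(v := u))"
proof -
  obtain h where h: "\<And>w. w < n \<Longrightarrow> w \<noteq> r \<Longrightarrow> p w \<le> n \<Longrightarrow>
      p w < n \<and> p (p w) \<le> n \<and> (p w, w) \<in> A \<and> h (p w) < (h w :: nat)"
    using t by (auto simp: partial_tree_def)
  have v: "v \<noteq> r" "u \<noteq> v" using t uv by (auto simp: partial_tree_def)
  have "p w \<noteq> v" if "w < n" "w \<noteq> r" "p w \<le> n" for w using h[OF that] uv by auto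
  then have "\<forall>w<n. w \<noteq> r \<and> (p(v := u)) w \<le> n \<longrightarrow> (p(v := u)) w < n \<and>
      (p(v := u)) ((p(v := u)) w) \<le> n \<and> ((p(v := u)) w, w) \<in> A \<and>
      (h(v := Suc (h u))) ((p(v := u)) w) < (h(v := Suc (h u))) w"
    using h uv v by auto
  moreover have "r < n" "(p(v := u)) r = n" using t v by (auto simp: partial_tree_def)
  ultimately show ?thesis unfolding partial_tree_def by blast
qed

lemma partial_tree_all:
  "partial_tree n A r p \<Longrightarrow> \<forall>v<n. p v \<le> n \<Longrightarrow> parent_tree n A r p"
  unfolding partial_tree_def parent_tree_def by blast

definition children :: "nat \<Rightarrow> (nat \<Rightarrow> nat) \<Rightarrow> nat \<Rightarrow> nat set" where
  "children n p x = {w. w < n \<and> p w = x}"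

lemma finite_children [simp]: "finite (children n p x)"
  by (simp add: children_def)

text \<open>All \<open>x\<close> are covered, also the marker \<open>n\<close>, whose only child in
  a parent tree is the root. This gives \<open>ch (p v)\<close> a meaning for the root as
  well.\<close>

definition child_count :: "nat \<Rightarrow> (nat \<Rightarrow> nat) \<Rightarrow> (nat \<Rightarrow> nat) \<Rightarrow> bool" where
  "child_count n p ch \<longleftrightarrow> (\<forall>x. ch x = card (children n p x))"

lemma child_count_pos: "child_count n p ch \<Longrightarrow> 0 < ch x \<longleftrightarrow> (\<exists>w<n. p w = x)"
  by (auto simp: child_count_def card_gt_0_iff) (auto simp: children_def)

text \<open>
  The negation of \<open>settled\<close> allows an improvement: an arc between two leaves whose head has a sibling.
  An improvement does not destroy settled pairs: internal vertices remain internal, and only a leaf can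
  gain a child.  This is why a single pass over all pairs reaches a local optimum.
\<close>

definition settled :: "(nat \<Rightarrow> nat) \<Rightarrow> (nat \<Rightarrow> nat) \<Rightarrow> nat \<Rightarrow> nat \<Rightarrow> bool" where
  "settled p ch u v \<longleftrightarrow> 0 < ch u \<or> 0 < ch v \<or> ch (p v) \<le> 1"

lemma improve_step:
  assumes t: "parent_tree n A r p" and ch: "child_count n p ch"
    and uv: "u < n" "v < n" "(u, v) \<in> A" "u \<noteq> v" "ch u = 0" "ch v = 0" "2 \<le> ch (p v)"
  defines "p' \<equiv> p(v := u)" and "ch' \<equiv> ch(p v := ch (p v) - 1, u := 1)"
  shows "parent_tree n A r p'" "child_count n p' ch'" "settled p' ch' u v"
    and "\<And>a b. a < n \<Longrightarrow> b < n \<Longrightarrow> settled p ch a b \<Longrightarrow> settled p' ch' a b"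
proof -
  obtain h where h: "\<And>w. w < n \<Longrightarrow> w \<noteq> r \<Longrightarrow> p w < n \<and> (p w, w) \<in> A \<and> h (p w) < (h w :: nat)"
    and r: "r < n" "p r = n"
    using t by (auto simp: parent_tree_def)
  have not_parent: "p w \<noteq> u" "p w \<noteq> v" if "w < n" for w
    using child_count_pos[OF ch] uv that by (metis less_irrefl)+
  \<comment> \<open>The marker \<open>n\<close> has the root as its only child, so
    \<open>2 \<le> ch (p v)\<close> also protects the root from being moved.\<close>
  have "v \<noteq> r"
  proof
    assume v: "v = r"
    have "w = r" if "w < n" "p w = n" for w using h[OF that(1)] that(2) by auto
    then have "children n p n = {r}" using r unfolding children_def by blast
    then show False using ch uv(7) v r by (simp add: child_count_def)
  qed
  then have "r < n" "p' r = n" using r by (simp_all add: p'_def)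
  \<comment> \<open>The leaf \<open>v\<close> is no parent, so its height is compared only with that
    of its new parent \<open>u\<close>.\<close>
  moreover have "p' w < n \<and> (p' w, w) \<in> A \<and> (h(v := Suc (h u))) (p' w) < (h(v := Suc (h u))) w"
    if "w < n" "w \<noteq> r" for w
    using h[OF that] not_parent(2)[OF that(1)] uv by (cases "w = v") (simp_all add: p'_def)
  ultimately have "r < n \<and> p' r = n \<and> (\<forall>w<n. w \<noteq> r \<longrightarrow>
      p' w < n \<and> (p' w, w) \<in> A \<and> (h(v := Suc (h u))) (p' w) < (h(v := Suc (h u))) w)"
    by blast
  then show "parent_tree n A r p'" unfolding parent_tree_def by blast
  have eqs: "children n p' u = {v}" "children n p' (p v) = children n p (p v) - {v}"
    "x \<noteq> u \<Longrightarrow> x \<noteq> p v \<Longrightarrow> children n p' x = children n p x" for x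
    using not_parent uv by (auto simp: children_def p'_def)
  have "v \<in> children n p (p v)" using uv by (simp add: children_def)
  then have "ch' x = card (children n p' x)" for x
    using eqs ch by (cases "x = u"; cases "x = p v") (auto simp: ch'_def child_count_def)
  then show "child_count n p' ch'" by (simp add: child_count_def)
  show "settled p' ch' u v" by (simp add: settled_def ch'_def)
  \<comment> \<open>Positive counts stay positive, and only the count of \<open>u\<close> rises. For
    \<open>b = v\<close> the new parent has count 1; any other \<open>b\<close> keeps its parent,
    which is not \<open>u\<close>.\<close>
  show "settled p' ch' a b" if "a < n" "b < n" "settled p ch a b" for a b
    using that not_parent[of b] uv by (auto simp: settled_def p'_def ch'_def)
qed

text \<open>
  For \<open>n = 1\<close> the root counts as an only child, namely of the marker \<open>n\<close>; otherwise the root is internal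
  and does not matter.
\<close>

lemma card_cover:
  assumes t: "parent_tree n A r p" and ch: "child_count n p ch" and "x < n"
  defines "I \<equiv> {v. v < n \<and> 0 < ch v}"
  shows "card (insert x (I \<union> {v. v < n \<and> ch (p v) \<le> 1})) \<le> 2 * card I + 1"
proof (cases "n = 1")
  case True
  then have "insert x (I \<union> {v. v < n \<and> ch (p v) \<le> 1}) \<subseteq> {0}" using \<open>x < n\<close> by (auto simp: I_def)
  then have "card (insert x (I \<union> {v. v < n \<and> ch (p v) \<le> 1})) \<le> card {0::nat}"
    by (intro card_mono) auto
  then show ?thesis by simp
next
  case False
  obtain h where h: "\<And>w. w < n \<Longrightarrow> w \<noteq> r \<Longrightarrow> p w < n \<and> (p w, w) \<in> A \<and> h (p w) < (h w :: nat)"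
    and r: "r < n" "p r = n"
    using t by (auto simp: parent_tree_def)
  let ?O = "{v. v < n \<and> ch (p v) \<le> 1}"
  have "\<exists>v<n. v \<noteq> r"
    using False r(1) by (intro exI[of _ "if r = 0 then 1 else 0"]) auto
  \<comment> \<open>A lowest vertex other than the root must hang directly below the root, which
    makes the root internal.\<close>
  then obtain v where v: "v < n" "v \<noteq> r" and vmin: "\<And>w. w < n \<Longrightarrow> w \<noteq> r \<Longrightarrow> h v \<le> h w"
    using ex_has_least_nat[of "\<lambda>v. v < n \<and> v \<noteq> r" _ h] by blast
  have "p v = r" using h[OF v] vmin[of "p v"] by force
  then have "r \<in> I" using child_count_pos[OF ch] v r by (auto simp: I_def)
  then have "insert x (I \<union> ?O) = insert x (I \<union> (?O - {r}))" by auto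
  then have "card (insert x (I \<union> ?O)) \<le> Suc (card (I \<union> (?O - {r})))"
    by (simp add: I_def card_insert_if)
  also have "card (I \<union> (?O - {r})) \<le> card I + card (?O - {r})" by (rule card_Un_le)
  also have "card (?O - {r}) \<le> card I"
  proof (rule card_inj_on_le[of p])
    show "inj_on p (?O - {r})"
    proof (rule inj_onI)
      fix a b assume *: "a \<in> ?O - {r}" "b \<in> ?O - {r}" "p a = p b"
      then have "card (children n p (p a)) \<le> Suc 0" using ch by (simp add: child_count_def)
      then show "a = b" using * by (auto simp: card_le_Suc0_iff_eq children_def)
    qed
    show "p ` (?O - {r}) \<subseteq> I" using h child_count_pos[OF ch] by (auto simp: I_def)
  qed (simp add: I_def)
  finally show ?thesis by simp
qed

lemma card_leaves_parent_arcs: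
  assumes t: "parent_tree n A r p" and ch: "child_count n p ch"
  shows "int (card (leaves (with_proj \<lparr>pverts = {..<n}, parcs = parent_arcs {..<n} r p\<rparr>)))
    = int n - int (card {v. v < n \<and> 0 < ch v})"
proof -
  let ?B = "with_proj \<lparr>pverts = {..<n}, parcs = parent_arcs {..<n} r p\<rparr>"
  have r: "p r = n" using t by (simp add: parent_tree_def)
  have "out_degree ?B v = 0 \<longleftrightarrow> \<not> 0 < ch v" if "v < n" for v
  proof -
    have "out_arcs ?B v = (\<lambda>w. (v, w)) ` children n p v"
      using that r by (auto simp: out_arcs_def parent_arcs_def children_def)
    then have "out_degree ?B v = card (children n p v)"
      by (simp add: out_degree_def card_image inj_on_def)
    then show ?thesis using ch by (simp add: child_count_def)
  qed
  then have "leaves ?B = {..<n} - {v. v < n \<and> 0 < ch v}" by (auto simp: leaves_def)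
  moreover have "card ({..<n} - {v. v < n \<and> 0 < ch v}) = n - card {v. v < n \<and> 0 < ch v}"
    by (subst card_Diff_subset) auto
  moreover have "card {v. v < n \<and> 0 < ch v} \<le> card {..<n}" by (rule card_mono) auto
  ultimately show ?thesis by simp
qed

section \<open>The program\<close>

text \<open>Cells 0, 1 and 2 of the input hold its length, \<open>k\<close> and \<open>n\<close>,
  hence the constant 3. The machine has no product, so row offsets come from a table built by
  repeated addition.\<close>

definition adj :: expr where
  "adj = Get ''in'' (Plus (Const 3) (Plus (Get ''r'' (Var ''u'')) (Var ''v'')))"

definition prologue :: com where
  "prologue = Seq (Assign ''k'' (Get ''in'' (Const 1))) (Seq (Assign ''n'' (Get ''in'' (Const 2)))
     (For ''u'' (Put ''r'' (Plus (Var ''u'') (Const 1)) (Plus (Get ''r'' (Var ''u'')) (Var ''n'')))))"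

text \<open>
  The array \<open>r\<close> holds the offsets \<open>u * n\<close> of the rows of the adjacency matrix, \<open>p\<close> the parents, \<open>c\<close> the
  numbers of children, \<open>d\<close> whether a spanning tree has been found, and \<open>m\<close> the number of internal
  vertices.
\<close>

definition search_round :: com where
  "search_round = For ''u'' (For ''v''
     (IfNZ (AndE adj (AndE (Minus (Plus (Var ''n'') (Const 1)) (Get ''p'' (Var ''u'')))
                           (Minus (Get ''p'' (Var ''v'')) (Var ''n''))))
        (Put ''p'' (Var ''v'') (Var ''u''))
        Skip))"

definition search :: com where
  "search = Seq (For ''u'' (Put ''p'' (Var ''u'') (Plus (Var ''n'') (Const 1))))
     (Seq (Put ''p'' (Var ''q'') (Var ''n''))
     (Seq (For ''i'' search_round)
     (Seq (Assign ''d'' (Const 1))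
          (For ''u'' (IfNZ (Minus (Get ''p'' (Var ''u'')) (Var ''n'')) (Assign ''d'' (Const 0)) Skip)))))"

definition find_tree :: com where
  "find_tree = For ''q'' (IfNZ (Var ''d'') Skip search)"

definition count_children :: com where
  "count_children = For ''v'' (Put ''c'' (Get ''p'' (Var ''v''))
     (Plus (Get ''c'' (Get ''p'' (Var ''v''))) (Const 1)))"

text \<open>The count of the old parent is lowered while \<open>p\<close> still points to it.
  Writing 1 for \<open>u\<close> is correct because \<open>u\<close> was a leaf.\<close>

definition improve :: com where
  "improve = For ''u'' (For ''v''
     (IfNZ (AndE adj (AndE (NotE (Get ''c'' (Var ''u''))) (AndE (NotE (Get ''c'' (Var ''v'')))
              (Minus (Get ''c'' (Get ''p'' (Var ''v''))) (Const 1)))))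
        (Seq (Put ''c'' (Get ''p'' (Var ''v'')) (Minus (Get ''c'' (Get ''p'' (Var ''v''))) (Const 1)))
        (Seq (Put ''c'' (Var ''u'') (Const 1))
             (Put ''p'' (Var ''v'') (Var ''u''))))
        Skip))"

definition tally :: com where
  "tally = For ''v'' (IfNZ (Get ''c'' (Var ''v'')) (Assign ''m'' (Plus (Var ''m'') (Const 1))) Skip)"

definition emit_branching :: com where
  "emit_branching = Seq (emit (Const 1)) (Seq (emit (Var ''n''))
     (emit_matrix (NotE (NeqE (Get ''p'' (Var ''v'')) (Var ''u'')))))"

text \<open>\<open>Minus (Const 2) x\<close> is nonzero exactly for \<open>x \<le> 1\<close>; sums
  act as disjunctions and a double \<open>NotE\<close> turns them into 0 or 1. The first matrix is
  the star with centre 0, the second the bags.\<close>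

definition emit_decomposition :: com where
  "emit_decomposition = Seq (emit (Const 0)) (Seq (emit (Var ''n''))
     (Seq (emit_matrix (NeqE (NotE (Var ''u'')) (NotE (Var ''v''))))
          (emit_matrix (NotE (NotE (Plus (NotE (NeqE (Var ''u'') (Var ''v'')))
             (Plus (Get ''c'' (Var ''v''))
                   (Minus (Const 2) (Get ''c'' (Get ''p'' (Var ''v''))))))))))) "

definition program :: com where
  "program = Seq prologue (Seq find_tree (Seq count_children (Seq improve (Seq tally
     (IfNZ (Minus (Var ''k'') (Var ''m'')) emit_decomposition emit_branching)))))"

definition env :: "nat \<Rightarrow> nat \<Rightarrow> nat rel \<Rightarrow> memory \<Rightarrow> bool" where
  "env n k A s \<longleftrightarrow> s ''n'' 0 = n \<and> s ''k'' 0 = k \<and> (\<forall>u<n. s ''r'' u = u * n) \<and>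
     (\<forall>u<n. \<forall>v<n. s ''in'' (3 + (u * n + v)) = of_bool ((u, v) \<in> A))"

lemma env_upd [simp]:
  "a \<noteq> ''n'' \<Longrightarrow> a \<noteq> ''k'' \<Longrightarrow> a \<noteq> ''r'' \<Longrightarrow> a \<noteq> ''in'' \<Longrightarrow> env n k A (s(a := f)) \<longleftrightarrow> env n k A s"
  by (simp add: env_def)

lemma env_n: "env n k A s \<Longrightarrow> s ''n'' 0 = n"
  and env_k: "env n k A s \<Longrightarrow> s ''k'' 0 = k"
  by (simp_all add: env_def)

lemma val_adj:
  "env n k A s \<Longrightarrow> s ''u'' 0 < n \<Longrightarrow> s ''v'' 0 < n \<Longrightarrow>
    val adj s = of_bool ((s ''u'' 0, s ''v'' 0) \<in> A)"
  by (simp add: env_def adj_def)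

definition clean :: "memory \<Rightarrow> bool" where
  "clean s \<longleftrightarrow> s ''c'' = (\<lambda>_. 0) \<and> s ''m'' 0 = 0 \<and> s ''out'' 0 = 0"

lemma clean_upd [simp]:
  "a \<noteq> ''c'' \<Longrightarrow> a \<noteq> ''m'' \<Longrightarrow> a \<noteq> ''out'' \<Longrightarrow> clean (s(a := f)) \<longleftrightarrow> clean s"
  by (simp add: clean_def)

lemma wp_prologue:
  fixes n k :: nat and A :: "nat rel"
  defines "xs \<equiv> k # n # matrix_list n n (\<lambda>u v. of_bool ((u, v) \<in> A))"
  assumes "\<And>s. env n k A s \<Longrightarrow> clean s \<Longrightarrow> s ''d'' 0 = 0 \<Longrightarrow> Q s"
  shows "wp prologue (1 + (1 + loop_time n 1)) Q (initial xs)"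
proof -
  have len: "length xs = 2 + n * n" by (simp add: xs_def)
  have entry: "initial xs ''in'' (3 + (u * n + v)) = of_bool ((u, v) \<in> A)" if "u < n" "v < n" for u v
  proof -
    have "Suc u * n \<le> n * n" using that by (intro mult_le_mono1) simp
    then have "u * n + v < n * n" using that by simp
    then show ?thesis
      using nth_matrix_list[OF that, of "\<lambda>u v. of_bool ((u, v) \<in> A)"] len
      by (simp add: initial_def xs_def numeral_3_eq_3)
  qed
  have sizes: "initial xs ''in'' 1 = k" "initial xs ''in'' 2 = n"
    by (simp_all add: initial_def xs_def numeral_2_eq_2)
  let ?K = "\<lambda>s. s ''n'' 0 = n \<and> s ''k'' 0 = k \<and> s ''in'' = initial xs ''in'' \<and> clean s \<and> s ''d'' 0 = 0"
  show ?thesis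
    unfolding prologue_def
  proof (intro wp_Seq wp_Put order_refl)
    let ?s1 = "(initial xs)(''k'' := (initial xs ''k'')(val (Const 0) (initial xs) := val (Get ''in'' (Const 1)) (initial xs)))"
    let ?s2 = "?s1(''n'' := (?s1 ''n'')(val (Const 0) ?s1 := val (Get ''in'' (Const 2)) ?s1))"
    have init: "?K ?s2" "?s2 ''r'' 0 = 0"
      using sizes by (simp_all add: clean_def) (simp_all add: initial_def fun_eq_iff)
    show "wp (For ''u'' (Put ''r'' (Plus (Var ''u'') (Const 1)) (Plus (Get ''r'' (Var ''u'')) (Var ''n''))))
        (loop_time n 1) Q ?s2"
    \<comment> \<open>The bound \<open>i \<le> j\<close> is not strict: cell 0 is zero from the
      start, and round \<open>j\<close> fills cell \<open>Suc j\<close>.\<close>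
    proof (rule wp_For[where I = "\<lambda>j s. ?K s \<and> (\<forall>i\<le>j. s ''r'' i = i * n)"])
      fix j s assume "j < n" "?K s \<and> (\<forall>i\<le>j. s ''r'' i = i * n)" "s ''u'' 0 = j" "s ''n'' 0 = n"
      then show "wp (Put ''r'' (Plus (Var ''u'') (Const 1)) (Plus (Get ''r'' (Var ''u'')) (Var ''n''))) 1
          (\<lambda>s. (?K s \<and> (\<forall>i\<le>Suc j. s ''r'' i = i * n)) \<and> s ''u'' 0 = j \<and> s ''n'' 0 = n) s"
        by (intro wp_Put) (auto simp: le_Suc_eq)
    next
      fix s assume "?K s \<and> (\<forall>i\<le>n. s ''r'' i = i * n)" "s ''n'' 0 = n"
      then show "Q s" using entry by (intro assms) (auto simp: env_def)
    qed (use init in auto)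
  qed
qed

section \<open>Correctness of the tree search\<close>

definition reached :: "nat \<Rightarrow> (nat \<Rightarrow> nat) \<Rightarrow> nat set" where
  "reached n p = {v. v < n \<and> p v \<le> n}"

definition closed_under :: "nat \<Rightarrow> nat rel \<Rightarrow> nat set \<Rightarrow> bool" where
  "closed_under n A R \<longleftrightarrow> (\<forall>a b. (a, b) \<in> A \<and> a \<in> R \<and> b < n \<longrightarrow> b \<in> R)"

lemma reached_le: "card (reached n p) \<le> n"
  using card_mono[of "{..<n}" "reached n p"] by (auto simp: reached_def)

text \<open>A round inspects all arcs leaving the set \<open>R\<close> reached at its start, so if
  nothing new is reached then \<open>R\<close> was closed. Vertices reached during the round may
  themselves be extended at once.\<close>

lemma wp_search_round:
  assumes s: "env n k A s" "clean s" "s ''q'' 0 = q" "s ''i'' 0 = i" "partial_tree n A q (s ''p'')"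
    and R: "R = reached n (s ''p'')"
    and Q: "\<And>s'. env n k A s' \<Longrightarrow> clean s' \<Longrightarrow> s' ''q'' 0 = q \<Longrightarrow> s' ''i'' 0 = i \<Longrightarrow>
      partial_tree n A q (s' ''p'') \<Longrightarrow>
      (closed_under n A R \<longrightarrow> reached n (s' ''p'') = R) \<Longrightarrow>
      closed_under n A (reached n (s' ''p'')) \<or> card R < card (reached n (s' ''p'')) \<Longrightarrow> Q s'"
  shows "wp search_round (loop_time n (loop_time n (1 + 1))) Q s"
proof -
  let ?P = "\<lambda>s. env n k A s \<and> clean s \<and> s ''q'' 0 = q \<and> s ''i'' 0 = i \<and> partial_tree n A q (s ''p'')
    \<and> R \<subseteq> reached n (s ''p'') \<and> (closed_under n A R \<longrightarrow> reached n (s ''p'') = R)"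
  let ?D = "\<lambda>u v p. \<forall>a b. (a, b) \<in> A \<and> a \<in> R \<and> b < n \<and> (a < u \<or> a = u \<and> b < v) \<longrightarrow> b \<in> reached n p"
  show ?thesis
    unfolding search_round_def
  proof (rule wp_For2[where I = "\<lambda>u v s. ?P s \<and> ?D u v (s ''p'')"])
    fix u v s
    assume uv: "u < n" "v < n" and P: "?P s \<and> ?D u v (s ''p'')"
      and s: "s ''u'' 0 = u" "s ''v'' 0 = v" "s ''n'' 0 = n"
    have adj: "val adj s = of_bool ((u, v) \<in> A)" using val_adj[of n k A s] P uv s by simp
    let ?p = "s ''p''"
    have D: "?D u (Suc v) p'"
      if "reached n ?p \<subseteq> reached n p'" "(u, v) \<in> A \<Longrightarrow> u \<in> R \<Longrightarrow> v \<in> reached n p'" for p'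
    proof (intro allI impI)
      fix a b assume ab: "(a, b) \<in> A \<and> a \<in> R \<and> b < n \<and> (a < u \<or> a = u \<and> b < Suc v)"
      show "b \<in> reached n p'"
      proof (cases "a = u \<and> b = v")
        case False
        then have "a < u \<or> a = u \<and> b < v" using ab by auto
        then show ?thesis using ab P that(1) by blast
      qed (use ab that(2) in blast)
    qed
    show "wp (IfNZ (AndE adj (AndE (Minus (Plus (Var ''n'') (Const 1)) (Get ''p'' (Var ''u'')))
           (Minus (Get ''p'' (Var ''v'')) (Var ''n'')))) (Put ''p'' (Var ''v'') (Var ''u'')) Skip) (1 + 1)
       (\<lambda>s. (?P s \<and> ?D u (Suc v) (s ''p'')) \<and> s ''u'' 0 = u \<and> s ''v'' 0 = v \<and> s ''n'' 0 = n) s"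
    proof (intro wp_If wp_Put wp_Skip order_refl)
      assume "val (AndE adj (AndE (Minus (Plus (Var ''n'') (Const 1)) (Get ''p'' (Var ''u'')))
           (Minus (Get ''p'' (Var ''v'')) (Var ''n'')))) s \<noteq> 0"
      then have c: "(u, v) \<in> A" "?p u \<le> n" "n < ?p v" using adj s by (auto split: if_splits)
      then have t: "partial_tree n A q (?p(v := u))"
        using partial_tree_upd[of n A q ?p u v] P uv by blast
      have r: "reached n (?p(v := u)) = insert v (reached n ?p)"
        using uv by (auto simp: reached_def)
      \<comment> \<open>Were \<open>R\<close> closed, nothing would have been added so far, and the
        arc \<open>(u, v)\<close> would lead out of \<open>R\<close>.\<close>
      have "\<not> closed_under n A R"
      proof
        assume cl: "closed_under n A R"
        then have "R = reached n ?p" using P by blast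
        then have "u \<in> R" "v \<notin> R" using c uv by (auto simp: reached_def)
        then show False using cl c uv unfolding closed_under_def by blast
      qed
      then have "?P (s(''p'' := ?p(v := u))) \<and> ?D u (Suc v) (?p(v := u))"
        using P t r by (intro conjI D) (simp_all, blast+)
      then show "(?P (s(''p'' := ?p(val (Var ''v'') s := val (Var ''u'') s))) \<and>
          ?D u (Suc v) ((s(''p'' := ?p(val (Var ''v'') s := val (Var ''u'') s))) ''p'')) \<and>
          (s(''p'' := ?p(val (Var ''v'') s := val (Var ''u'') s))) ''u'' 0 = u \<and>
          (s(''p'' := ?p(val (Var ''v'') s := val (Var ''u'') s))) ''v'' 0 = v \<and>
          (s(''p'' := ?p(val (Var ''v'') s := val (Var ''u'') s))) ''n'' 0 = n"
        by (simp add: s) blast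
    next
      assume "val (AndE adj (AndE (Minus (Plus (Var ''n'') (Const 1)) (Get ''p'' (Var ''u'')))
           (Minus (Get ''p'' (Var ''v'')) (Var ''n'')))) s = 0"
      then have "\<not> ((u, v) \<in> A \<and> ?p u \<le> n \<and> n < ?p v)" using adj s by (auto split: if_splits)
      then have "v \<in> reached n ?p" if "(u, v) \<in> A" "u \<in> R"
      proof -
        have "u \<in> reached n ?p" using that(2) P by blast
        then show ?thesis using \<open>\<not> (_ \<and> _)\<close> that(1) uv by (simp add: reached_def)
      qed
      then have "?D u (Suc v) ?p" by (intro D) blast+
      then show "(?P s \<and> ?D u (Suc v) ?p) \<and> s ''u'' 0 = u \<and> s ''v'' 0 = v \<and> s ''n'' 0 = n"
        using P s by blast
    qed
  next
    fix s assume P: "?P s \<and> ?D n 0 (s ''p'')"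
    let ?R = "reached n (s ''p'')"
    have "closed_under n A ?R \<or> card R < card ?R"
    proof (cases "?R = R")
      case True
      then have "closed_under n A ?R"
        using P unfolding closed_under_def by (metis (no_types, lifting) mem_Collect_eq reached_def)
      then show ?thesis ..
    next
      case False
      then have "R \<subset> ?R" using P by auto
      then have "card R < card ?R" by (intro psubset_card_mono) (auto simp: reached_def)
      then show ?thesis ..
    qed
    then show "Q s" using P by (intro Q) blast+
  next
    fix i s assume I: "?P s \<and> ?D i n (s ''p'')"
    have "?D (Suc i) 0 (s ''p'')"
    proof (intro allI impI)
      fix a b assume ab: "(a, b) \<in> A \<and> a \<in> R \<and> b < n \<and> (a < Suc i \<or> a = Suc i \<and> b < 0)"
      then have "a < i \<or> a = i \<and> b < n" by auto
      then show "b \<in> reached n (s ''p'')" using ab I by blast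
    qed
    then show "?P s \<and> ?D (Suc i) 0 (s ''p'')" using I by blast
  qed ((use s R in \<open>simp_all add: env_n\<close>), blast+)
qed

definition search_time :: "'a::comm_semiring_1 \<Rightarrow> 'a" where
  "search_time n = loop_time n 1 + (1 + (loop_time n (loop_time n (loop_time n (1 + 1)))
     + (1 + loop_time n (1 + 1))))"

text \<open>After \<open>j\<close> rounds the reached set is closed or has more than
  \<open>j\<close> elements; as it has at most \<open>n\<close>, it is closed after \<open>n\<close>
  rounds. A closed set containing \<open>q\<close> contains everything reachable from
  \<open>q\<close>, so an unreached vertex refutes \<open>q\<close> as a root.\<close>

lemma wp_search:
  assumes s: "env n k A s" "clean s" "s ''q'' 0 = q" "q < n"
    and Q: "\<And>s'. env n k A s' \<Longrightarrow> clean s' \<Longrightarrow> s' ''q'' 0 = q \<Longrightarrow>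
      s' ''d'' 0 = 1 \<and> parent_tree n A q (s' ''p'') \<or>
      s' ''d'' 0 = 0 \<and> (\<exists>v<n. (q, v) \<notin> (A \<inter> {..<n} \<times> {..<n})\<^sup>*) \<Longrightarrow> Q s'"
  shows "wp search (search_time n) Q s"
proof -
  let ?K = "\<lambda>s. env n k A s \<and> clean s \<and> s ''q'' 0 = q"
  let ?J = "\<lambda>s. ?K s \<and> partial_tree n A q (s ''p'') \<and> closed_under n A (reached n (s ''p''))"
  have check: "wp (For ''u'' (IfNZ (Minus (Get ''p'' (Var ''u'')) (Var ''n'')) (Assign ''d'' (Const 0)) Skip))
      (loop_time n (1 + 1)) Q s" if "?J s" "s ''d'' 0 = 1" for s
  proof (rule wp_For[where I = "\<lambda>j s. ?J s \<and> s ''d'' 0 = of_bool (\<forall>v<j. s ''p'' v \<le> n)"])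
    fix j s assume *: "j < n" "?J s \<and> s ''d'' 0 = of_bool (\<forall>v<j. s ''p'' v \<le> n)"
      "s ''u'' 0 = j" "s ''n'' 0 = n"
    show "wp (IfNZ (Minus (Get ''p'' (Var ''u'')) (Var ''n'')) (Assign ''d'' (Const 0)) Skip) (1 + 1)
       (\<lambda>s. (?J s \<and> s ''d'' 0 = of_bool (\<forall>v<Suc j. s ''p'' v \<le> n)) \<and> s ''u'' 0 = j \<and> s ''n'' 0 = n) s"
      by (intro wp_If wp_Put wp_Skip order_refl) (use * in \<open>auto simp: less_Suc_eq\<close>)
  next
    fix s assume *: "?J s \<and> s ''d'' 0 = of_bool (\<forall>v<n. s ''p'' v \<le> n)"
    have "\<exists>v<n. (q, v) \<notin> (A \<inter> {..<n} \<times> {..<n})\<^sup>*" if "\<not> (\<forall>v<n. s ''p'' v \<le> n)"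
    proof (rule ccontr)
      assume none: "\<not> (\<exists>v<n. (q, v) \<notin> (A \<inter> {..<n} \<times> {..<n})\<^sup>*)"
      have "v \<in> reached n (s ''p'')" if "(q, v) \<in> (A \<inter> {..<n} \<times> {..<n})\<^sup>*" for v
        using that
      proof (induction rule: rtrancl_induct)
        case base
        then show ?case using * by (auto simp: partial_tree_def reached_def)
      next
        case (step v w)
        then show ?case using * unfolding closed_under_def by blast
      qed
      then show False using none that by (auto simp: reached_def)
    qed
    then show "Q s"
      using * partial_tree_all[of n A q "s ''p''"] by (intro Q) auto
  qed (use that in \<open>auto simp: env_n\<close>)
  have main: "wp (Seq (For ''i'' search_round) (Seq (Assign ''d'' (Const 1))
      (For ''u'' (IfNZ (Minus (Get ''p'' (Var ''u'')) (Var ''n'')) (Assign ''d'' (Const 0)) Skip))))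
      (loop_time n (loop_time n (loop_time n (1 + 1))) + (1 + loop_time n (1 + 1))) Q s"
    if "?K s" "partial_tree n A q (s ''p'')" for s
  proof (rule wp_Seq, rule wp_For[where I = "\<lambda>j s. ?K s \<and> partial_tree n A q (s ''p'') \<and>
      (closed_under n A (reached n (s ''p'')) \<or> j < card (reached n (s ''p'')))"])
    fix j s assume *: "j < n" "?K s \<and> partial_tree n A q (s ''p'') \<and>
      (closed_under n A (reached n (s ''p'')) \<or> j < card (reached n (s ''p'')))"
      "s ''i'' 0 = j" "s ''n'' 0 = n"
    show "wp search_round (loop_time n (loop_time n (1 + 1)))
      (\<lambda>s. (?K s \<and> partial_tree n A q (s ''p'') \<and>
      (closed_under n A (reached n (s ''p'')) \<or> Suc j < card (reached n (s ''p'')))) \<and> s ''i'' 0 = j \<and> s ''n'' 0 = n) s"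
    proof (rule wp_search_round[OF _ _ _ _ _ refl])
      fix s'
      assume s': "env n k A s'" "clean s'" "s' ''q'' 0 = q" "s' ''i'' 0 = j" "partial_tree n A q (s' ''p'')"
        and stable: "closed_under n A (reached n (s ''p'')) \<longrightarrow> reached n (s' ''p'') = reached n (s ''p'')"
        and grow: "closed_under n A (reached n (s' ''p'')) \<or> card (reached n (s ''p'')) < card (reached n (s' ''p''))"
      have "closed_under n A (reached n (s' ''p'')) \<or> Suc j < card (reached n (s' ''p''))"
      proof (cases "closed_under n A (reached n (s ''p''))")
        case True
        then show ?thesis using stable by simp
      next
        case False
        then have "j < card (reached n (s ''p''))" using * by blast
        then show ?thesis using grow by linarith
      qed
      then show "(?K s' \<and> partial_tree n A q (s' ''p'') \<and>
        (closed_under n A (reached n (s' ''p'')) \<or> Suc j < card (reached n (s' ''p'')))) \<and>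
        s' ''i'' 0 = j \<and> s' ''n'' 0 = n"
        using s' env_n[OF s'(1)] by blast
    qed (use * in simp_all)
  next
    fix s assume *: "?K s \<and> partial_tree n A q (s ''p'') \<and>
      (closed_under n A (reached n (s ''p'')) \<or> n < card (reached n (s ''p'')))"
    then have "?J s" using reached_le[of n "s ''p''"] by auto
    then show "wp (Seq (Assign ''d'' (Const 1)) (For ''u'' (IfNZ (Minus (Get ''p'' (Var ''u'')) (Var ''n''))
        (Assign ''d'' (Const 0)) Skip))) (1 + loop_time n (1 + 1)) Q s"
      by (intro wp_Seq wp_Put check) auto
  next
    have "q \<in> reached n (s ''p'')" using that by (auto simp: partial_tree_def reached_def)
    then have "0 < card (reached n (s ''p''))" by (auto simp: card_gt_0_iff reached_def)
    then show "?K s \<and> partial_tree n A q (s ''p'') \<and>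
      (closed_under n A (reached n (s ''p'')) \<or> 0 < card (reached n (s ''p'')))"
      using that by blast
  qed (use that in \<open>auto simp: env_n\<close>)
  show ?thesis
    unfolding search_def search_time_def
  proof (rule wp_Seq, rule wp_For[where I = "\<lambda>j s. ?K s \<and> (\<forall>v<j. s ''p'' v = Suc n)"])
    fix s assume *: "?K s \<and> (\<forall>v<n. s ''p'' v = Suc n)" "s ''n'' 0 = n"
    have "partial_tree n A q ((s ''p'')(q := n))"
      using * \<open>q < n\<close> by (auto simp: partial_tree_def)
    then show "wp (Seq (Put ''p'' (Var ''q'') (Var ''n'')) (Seq (For ''i'' search_round) (Seq (Assign ''d'' (Const 1))
      (For ''u'' (IfNZ (Minus (Get ''p'' (Var ''u'')) (Var ''n'')) (Assign ''d'' (Const 0)) Skip)))))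
      (1 + (loop_time n (loop_time n (loop_time n (1 + 1))) + (1 + loop_time n (1 + 1)))) Q s"
      using * by (intro wp_Seq[of "Put ''p'' (Var ''q'') (Var ''n'')"] wp_Put main) auto
  next
    fix j s assume "j < n" "?K s \<and> (\<forall>v<j. s ''p'' v = Suc n)" "s ''u'' 0 = j" "s ''n'' 0 = n"
    then show "wp (Put ''p'' (Var ''u'') (Plus (Var ''n'') (Const 1))) 1
      (\<lambda>s. (?K s \<and> (\<forall>v<Suc j. s ''p'' v = Suc n)) \<and> s ''u'' 0 = j \<and> s ''n'' 0 = n) s"
      by (intro wp_Put) (auto simp: less_Suc_eq)
  qed (use s in \<open>auto simp: env_n\<close>)
qed

text \<open>A failed trial cannot have been at \<open>r\<close>, so \<open>j \<le> r\<close>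
  persists as long as no tree is found, and \<open>r < n\<close> forces a success. The root found
  may be smaller than \<open>r\<close>.\<close>

lemma wp_find_tree:
  assumes s: "env n k A s" "clean s" "s ''d'' 0 = 0"
    and root: "r < n" "\<And>v. v < n \<Longrightarrow> (r, v) \<in> (A \<inter> {..<n} \<times> {..<n})\<^sup>*"
    and Q: "\<And>s' r. env n k A s' \<Longrightarrow> clean s' \<Longrightarrow> parent_tree n A r (s' ''p'') \<Longrightarrow> Q s'"
  shows "wp find_tree (loop_time n (1 + search_time n)) Q s"
  unfolding find_tree_def
proof (rule wp_For[where I = "\<lambda>j s. env n k A s \<and> clean s \<and>
    (s ''d'' 0 = 1 \<and> (\<exists>r. parent_tree n A r (s ''p'')) \<or> s ''d'' 0 = 0 \<and> j \<le> r)"])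
  fix j s assume *: "j < n" "env n k A s \<and> clean s \<and>
    (s ''d'' 0 = 1 \<and> (\<exists>r. parent_tree n A r (s ''p'')) \<or> s ''d'' 0 = 0 \<and> j \<le> r)"
    "s ''q'' 0 = j" "s ''n'' 0 = n"
  show "wp (IfNZ (Var ''d'') Skip search) (1 + search_time n)
     (\<lambda>s. (env n k A s \<and> clean s \<and>
      (s ''d'' 0 = 1 \<and> (\<exists>r. parent_tree n A r (s ''p'')) \<or> s ''d'' 0 = 0 \<and> Suc j \<le> r)) \<and>
      s ''q'' 0 = j \<and> s ''n'' 0 = n) s"
  proof (rule wp_If)
    assume "val (Var ''d'') s = 0"
    then have "j \<le> r" using * by auto
    show "wp search (search_time n) (\<lambda>s. (env n k A s \<and> clean s \<and>
      (s ''d'' 0 = 1 \<and> (\<exists>r. parent_tree n A r (s ''p'')) \<or> s ''d'' 0 = 0 \<and> Suc j \<le> r)) \<and>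
      s ''q'' 0 = j \<and> s ''n'' 0 = n) s"
    proof (rule wp_search[of n k A s j])
      fix s' assume s': "env n k A s'" "clean s'" "s' ''q'' 0 = j" and
        d: "s' ''d'' 0 = 1 \<and> parent_tree n A j (s' ''p'') \<or>
        s' ''d'' 0 = 0 \<and> (\<exists>v<n. (j, v) \<notin> (A \<inter> {..<n} \<times> {..<n})\<^sup>*)"
      have "Suc j \<le> r" if "\<exists>v<n. (j, v) \<notin> (A \<inter> {..<n} \<times> {..<n})\<^sup>*"
        using that root(2) \<open>j \<le> r\<close> by (metis Suc_leI le_neq_implies_less)
      then show "(env n k A s' \<and> clean s' \<and>
        (s' ''d'' 0 = 1 \<and> (\<exists>r. parent_tree n A r (s' ''p'')) \<or> s' ''d'' 0 = 0 \<and> Suc j \<le> r)) \<and>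
        s' ''q'' 0 = j \<and> s' ''n'' 0 = n"
        using s' d env_n[OF s'(1)] by blast
    qed (use * in auto)
  qed (intro wp_Skip, use * in \<open>auto simp: search_time_def\<close>)
next
  fix s assume "env n k A s \<and> clean s \<and>
    (s ''d'' 0 = 1 \<and> (\<exists>r. parent_tree n A r (s ''p'')) \<or> s ''d'' 0 = 0 \<and> n \<le> r)"
  then show "Q s" using root(1) Q by auto
qed (use s in \<open>auto simp: env_n\<close>)

section \<open>Counting children and the improvement pass\<close>

definition counted :: "nat \<Rightarrow> nat \<Rightarrow> nat rel \<Rightarrow> memory \<Rightarrow> bool" where
  "counted n k A s \<longleftrightarrow> env n k A s \<and> s ''m'' 0 = 0 \<and> s ''out'' 0 = 0 \<and>
     (\<exists>r. parent_tree n A r (s ''p'')) \<and> child_count n (s ''p'') (s ''c'')"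

lemma counted_upd [simp]:
  "a \<notin> {''n'', ''k'', ''r'', ''in'', ''m'', ''out'', ''p'', ''c''} \<Longrightarrow> counted n k A (s(a := f)) \<longleftrightarrow> counted n k A s"
  by (auto simp: counted_def)

lemma wp_count_children:
  assumes s: "env n k A s" "clean s" "parent_tree n A r (s ''p'')"
    and Q: "\<And>s'. counted n k A s' \<Longrightarrow> Q s'"
  shows "wp count_children (loop_time n 1) Q s"
  unfolding count_children_def
\<comment> \<open>\<open>child_count j\<close> ranges over the children below \<open>j\<close>,
  exactly those counted before round \<open>j\<close>.\<close>
proof (rule wp_For[where I = "\<lambda>j s. env n k A s \<and> s ''m'' 0 = 0 \<and> s ''out'' 0 = 0 \<and>
    parent_tree n A r (s ''p'') \<and> child_count j (s ''p'') (s ''c'')"])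
  fix j s assume *: "j < n" "env n k A s \<and> s ''m'' 0 = 0 \<and> s ''out'' 0 = 0 \<and>
    parent_tree n A r (s ''p'') \<and> child_count j (s ''p'') (s ''c'')" "s ''v'' 0 = j" "s ''n'' 0 = n"
  have "children (Suc j) p x = (if p j = x then insert j (children j p x) else children j p x)" for p x
    by (auto simp: children_def less_Suc_eq)
  moreover have "j \<notin> children j p x" for p x by (simp add: children_def)
  ultimately have "child_count (Suc j) p (ch(p j := Suc (ch (p j))))" if "child_count j p ch" for p ch
    using that by (auto simp: child_count_def)
  then show "wp (Put ''c'' (Get ''p'' (Var ''v'')) (Plus (Get ''c'' (Get ''p'' (Var ''v''))) (Const 1))) 1
    (\<lambda>s. (env n k A s \<and> s ''m'' 0 = 0 \<and> s ''out'' 0 = 0 \<and>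
    parent_tree n A r (s ''p'') \<and> child_count (Suc j) (s ''p'') (s ''c'')) \<and> s ''v'' 0 = j \<and> s ''n'' 0 = n) s"
    using * by (intro wp_Put) auto
qed (use s Q in \<open>auto simp: env_n clean_def counted_def child_count_def children_def\<close>)

lemma wp_improve:
  assumes s: "counted n k A s" and irrefl: "\<And>v. (v, v) \<notin> A"
    and Q: "\<And>s'. counted n k A s' \<Longrightarrow>
      (\<And>a b. a < n \<Longrightarrow> b < n \<Longrightarrow> (a, b) \<in> A \<Longrightarrow> settled (s' ''p'') (s' ''c'') a b) \<Longrightarrow> Q s'"
  shows "wp improve (loop_time n (loop_time n (1 + (1 + (1 + 1))))) Q s"
  unfolding improve_def
proof (rule wp_For2[where I = "\<lambda>u v s. counted n k A s \<and> (\<forall>a<n. \<forall>b<n. (a, b) \<in> A \<and> (a < u \<or> a = u \<and> b < v) \<longrightarrow>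
    settled (s ''p'') (s ''c'') a b)"])
  let ?D = "\<lambda>u v s. \<forall>a<n. \<forall>b<n. (a, b) \<in> A \<and> (a < u \<or> a = u \<and> b < v) \<longrightarrow>
    settled (s ''p'') (s ''c'') a b"
  fix u v s
  assume uv: "u < n" "v < n" and I: "counted n k A s \<and> ?D u v s"
    and s: "s ''u'' 0 = u" "s ''v'' 0 = v" "s ''n'' 0 = n"
  let ?e = "AndE adj (AndE (NotE (Get ''c'' (Var ''u''))) (AndE (NotE (Get ''c'' (Var ''v'')))
              (Minus (Get ''c'' (Get ''p'' (Var ''v''))) (Const 1))))"
  let ?p = "s ''p''" and ?c = "s ''c''"
  have adj: "val adj s = of_bool ((u, v) \<in> A)" using val_adj[of n k A s] I uv s by (simp add: counted_def)
  have e: "val ?e s \<noteq> 0 \<longleftrightarrow> (u, v) \<in> A \<and> ?c u = 0 \<and> ?c v = 0 \<and> 2 \<le> ?c (?p v)"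
    using s adj by auto
  show "wp (IfNZ ?e (Seq (Put ''c'' (Get ''p'' (Var ''v'')) (Minus (Get ''c'' (Get ''p'' (Var ''v''))) (Const 1)))
        (Seq (Put ''c'' (Var ''u'') (Const 1)) (Put ''p'' (Var ''v'') (Var ''u'')))) Skip) (1 + (1 + (1 + 1)))
      (\<lambda>s. (counted n k A s \<and> ?D u (Suc v) s) \<and> s ''u'' 0 = u \<and> s ''v'' 0 = v \<and> s ''n'' 0 = n) s"
  proof (rule wp_If)
    assume "val ?e s \<noteq> 0"
    then have c: "(u, v) \<in> A" "?c u = 0" "?c v = 0" "2 \<le> ?c (?p v)" using e by auto
    \<comment> \<open>With a loop at \<open>u\<close> the test could succeed and make
      \<open>u\<close> its own parent.\<close>
    have "u \<noteq> v" using c irrefl by auto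
    obtain r where t: "parent_tree n A r ?p" "child_count n ?p ?c" using I by (auto simp: counted_def)
    note i = improve_step[OF t uv c(1) \<open>u \<noteq> v\<close> c(2-4)]
    define p' c' where "p' = ?p(v := u)" and "c' = ?c(?p v := ?c (?p v) - 1, u := 1)"
    have "counted n k A (s(''c'' := c', ''p'' := p'))"
      using I i(1,2) by (auto simp: counted_def p'_def c'_def)
    moreover have "?D u (Suc v) (s(''c'' := c', ''p'' := p'))"
      using I i(3,4) uv unfolding p'_def c'_def by (auto simp: less_Suc_eq)
    ultimately have "(counted n k A (s(''c'' := c', ''p'' := p')) \<and> ?D u (Suc v) (s(''c'' := c', ''p'' := p'))) \<and>
      (s(''c'' := c', ''p'' := p')) ''u'' 0 = u \<and> (s(''c'' := c', ''p'' := p')) ''v'' 0 = v \<and>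
      (s(''c'' := c', ''p'' := p')) ''n'' 0 = n"
      using s by simp
    then show "wp (Seq (Put ''c'' (Get ''p'' (Var ''v'')) (Minus (Get ''c'' (Get ''p'' (Var ''v''))) (Const 1)))
        (Seq (Put ''c'' (Var ''u'') (Const 1)) (Put ''p'' (Var ''v'') (Var ''u'')))) (1 + (1 + 1))
      (\<lambda>s. (counted n k A s \<and> ?D u (Suc v) s) \<and> s ''u'' 0 = u \<and> s ''v'' 0 = v \<and> s ''n'' 0 = n) s"
      by (intro wp_Seq wp_Put order_refl) (simp add: s p'_def c'_def)
  next
    assume "val ?e s = 0"
    then have "(u, v) \<in> A \<Longrightarrow> settled ?p ?c u v" using e by (auto simp: settled_def)
    then show "wp Skip (1 + (1 + 1))
      (\<lambda>s. (counted n k A s \<and> ?D u (Suc v) s) \<and> s ''u'' 0 = u \<and> s ''v'' 0 = v \<and> s ''n'' 0 = n) s"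
      using I s by (intro wp_Skip) (auto simp: less_Suc_eq)
  qed
qed (use s Q in \<open>auto simp: counted_def env_n less_Suc_eq\<close>)

text \<open>\<open>P\<close> transports what the improvement pass has achieved through a loop that
  changes neither \<open>p\<close> nor \<open>c\<close>.\<close>

lemma wp_tally:
  assumes s: "counted n k A s" "P (s ''p'') (s ''c'')"
    and Q: "\<And>s' r. env n k A s' \<Longrightarrow> parent_tree n A r (s' ''p'') \<Longrightarrow> child_count n (s' ''p'') (s' ''c'') \<Longrightarrow>
      P (s' ''p'') (s' ''c'') \<Longrightarrow> s' ''out'' 0 = 0 \<Longrightarrow> s' ''m'' 0 = card {v. v < n \<and> 0 < s' ''c'' v} \<Longrightarrow> Q s'"
  shows "wp tally (loop_time n (1 + 1)) Q s"
  unfolding tally_def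
proof (rule wp_For[where I = "\<lambda>j s. env n k A s \<and> s ''m'' 0 = card {v. v < j \<and> 0 < s ''c'' v} \<and>
    s ''out'' 0 = 0 \<and> (\<exists>r. parent_tree n A r (s ''p'')) \<and> child_count n (s ''p'') (s ''c'') \<and>
    P (s ''p'') (s ''c'')"])
  let ?I = "\<lambda>j s. env n k A s \<and> s ''m'' 0 = card {v. v < j \<and> 0 < s ''c'' v} \<and>
    s ''out'' 0 = 0 \<and> (\<exists>r. parent_tree n A r (s ''p'')) \<and> child_count n (s ''p'') (s ''c'') \<and>
    P (s ''p'') (s ''c'')"
  fix j s assume *: "j < n" "?I j s" "s ''v'' 0 = j" "s ''n'' 0 = n"
  have "{v. v < Suc j \<and> 0 < ch v} = (if 0 < ch j then insert j else id) {v. v < j \<and> 0 < ch v}" for ch :: "nat \<Rightarrow> nat"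
    by (auto simp: less_Suc_eq)
  then show "wp (IfNZ (Get ''c'' (Var ''v'')) (Assign ''m'' (Plus (Var ''m'') (Const 1))) Skip) (1 + 1)
      (\<lambda>s. ?I (Suc j) s \<and> s ''v'' 0 = j \<and> s ''n'' 0 = n) s"
    using * by (intro wp_If wp_Put wp_Skip order_refl) auto
qed (use s Q in \<open>auto simp: counted_def env_n\<close>)

section \<open>Output and the whole program\<close>

lemma wp_emit_branching:
  assumes s: "env n k A s" "s ''p'' = p" "s ''out'' 0 = 0"
    and Q: "\<And>s'. result s' = 1 # n # matrix_list n n (\<lambda>u v. of_bool (p v = u)) \<Longrightarrow> Q s'"
  shows "wp emit_branching (2 + (2 + loop_time n (loop_time n 2))) Q s"
  unfolding emit_branching_def
proof (rule wp_Seq, rule wp_emit)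
  fix f assume f: "result (s(''out'' := f)) = result s @ [1]"
  let ?s1 = "s(''out'' := f)"
  show "wp (Seq (emit (Var ''n'')) (emit_matrix (NotE (NeqE (Get ''p'' (Var ''v'')) (Var ''u'')))))
      (2 + loop_time n (loop_time n 2)) Q ?s1"
  proof (rule wp_Seq, rule wp_emit)
    fix g assume g: "result (?s1(''out'' := g)) = result ?s1 @ [n]"
    show "wp (emit_matrix (NotE (NeqE (Get ''p'' (Var ''v'')) (Var ''u''))))
        (loop_time n (loop_time n 2)) Q (?s1(''out'' := g))"
    proof (rule wp_emit_matrix[where K = "\<lambda>s. s ''p'' = p" and f = "\<lambda>u v. of_bool (p v = u)"])
      fix s' assume "result s' = result (?s1(''out'' := g)) @ matrix_list n n (\<lambda>u v. of_bool (p v = u))"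
      then show "Q s'" using f g s(3) by (intro Q) (simp add: result_def)
    qed (use s in \<open>auto simp: env_n\<close>)
  qed (use s in \<open>simp add: env_n\<close>)
qed simp

lemma wp_emit_decomposition:
  assumes s: "env n k A s" "s ''p'' = p" "s ''c'' = c" "s ''out'' 0 = 0"
    and Q: "\<And>s'. result s' = 0 # n # matrix_list n n (\<lambda>u v. of_bool ((u = 0) \<noteq> (v = 0))) @
      matrix_list n n (\<lambda>u v. of_bool (u = v \<or> 0 < c v \<or> c (p v) \<le> 1)) \<Longrightarrow> Q s'"
  shows "wp emit_decomposition (2 + (2 + (loop_time n (loop_time n 2) + loop_time n (loop_time n 2)))) Q s"
  unfolding emit_decomposition_def
proof (rule wp_Seq, rule wp_emit)
  let ?star = "NeqE (NotE (Var ''u'')) (NotE (Var ''v''))"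
  let ?bag = "NotE (NotE (Plus (NotE (NeqE (Var ''u'') (Var ''v'')))
    (Plus (Get ''c'' (Var ''v'')) (Minus (Const 2) (Get ''c'' (Get ''p'' (Var ''v'')))))))"
  fix f assume f: "result (s(''out'' := f)) = result s @ [0]"
  let ?s1 = "s(''out'' := f)"
  show "wp (Seq (emit (Var ''n'')) (Seq (emit_matrix ?star) (emit_matrix ?bag)))
      (2 + (loop_time n (loop_time n 2) + loop_time n (loop_time n 2))) Q ?s1"
  proof (rule wp_Seq, rule wp_emit)
    fix g assume g: "result (?s1(''out'' := g)) = result ?s1 @ [n]"
    let ?s2 = "?s1(''out'' := g)" and ?K = "\<lambda>s. s ''p'' = p \<and> s ''c'' = c"
    show "wp (Seq (emit_matrix ?star) (emit_matrix ?bag))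
        (loop_time n (loop_time n 2) + loop_time n (loop_time n 2)) Q ?s2"
    proof (rule wp_Seq, rule wp_emit_matrix[where K = ?K and f = "\<lambda>u v. of_bool ((u = 0) \<noteq> (v = 0))"])
      fix s3 assume s3: "?K s3" "s3 ''n'' 0 = n"
        "result s3 = result ?s2 @ matrix_list n n (\<lambda>u v. of_bool ((u = 0) \<noteq> (v = 0)))"
      show "wp (emit_matrix ?bag) (loop_time n (loop_time n 2)) Q s3"
      proof (rule wp_emit_matrix[where K = ?K and
            f = "\<lambda>u v. of_bool (u = v \<or> 0 < c v \<or> c (p v) \<le> 1)"])
        fix s' assume "result s' = result s3 @ matrix_list n n (\<lambda>u v. of_bool (u = v \<or> 0 < c v \<or> c (p v) \<le> 1))"
        then show "Q s'" using f g s3 s(4) by (intro Q) (simp add: result_def)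
      qed (use s3 in auto)
    qed (use s in \<open>auto simp: env_n\<close>)
  qed (use s in \<open>simp add: env_n\<close>)
qed simp

text \<open>The sums mirror the nesting of the program, so the rules for \<open>wp\<close> apply
  without rearrangement. Both final branches are charged for the longer output.\<close>

definition program_time :: "'a::comm_semiring_1 \<Rightarrow> 'a" where
  "program_time n = 1 + (1 + loop_time n 1) + (loop_time n (1 + search_time n) + (loop_time n 1 +
     (loop_time n (loop_time n (1 + (1 + (1 + 1)))) + (loop_time n (1 + 1) +
     (1 + (2 + (2 + (loop_time n (loop_time n 2) + loop_time n (loop_time n 2)))))))))"

lemma wp_program:
  assumes irrefl: "\<And>v. (v, v) \<notin> A"
    and root: "r < n" "\<And>v. v < n \<Longrightarrow> (r, v) \<in> (A \<inter> {..<n} \<times> {..<n})\<^sup>*"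
  shows "wp program (program_time n)
    (\<lambda>s. \<exists>r p c. parent_tree n A r p \<and> child_count n p c \<and>
      (\<forall>a<n. \<forall>b<n. (a, b) \<in> A \<longrightarrow> settled p c a b) \<and>
      (if k \<le> card {v. v < n \<and> 0 < c v}
       then result s = 1 # n # matrix_list n n (\<lambda>u v. of_bool (p v = u))
       else result s = 0 # n # matrix_list n n (\<lambda>u v. of_bool ((u = 0) \<noteq> (v = 0))) @
         matrix_list n n (\<lambda>u v. of_bool (u = v \<or> 0 < c v \<or> c (p v) \<le> 1))))
    (initial (k # n # matrix_list n n (\<lambda>u v. of_bool ((u, v) \<in> A))))"
  (is "wp _ _ ?Q _")
  unfolding program_def program_time_def
proof (rule wp_Seq, rule wp_prologue, rule wp_Seq, rule wp_find_tree[OF _ _ _ root])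
  let ?S = "\<lambda>p c. \<forall>a<n. \<forall>b<n. (a, b) \<in> A \<longrightarrow> settled p c a b"
  fix s r assume s: "env n k A s" "clean s" "parent_tree n A r (s ''p'')"
  show "wp (Seq count_children (Seq improve (Seq tally
     (IfNZ (Minus (Var ''k'') (Var ''m'')) emit_decomposition emit_branching))))
     (loop_time n 1 + (loop_time n (loop_time n (1 + (1 + (1 + 1)))) + (loop_time n (1 + 1) +
     (1 + (2 + (2 + (loop_time n (loop_time n 2) + loop_time n (loop_time n 2)))))))) ?Q s"
  proof (rule wp_Seq, rule wp_count_children[OF s], rule wp_Seq, rule wp_improve[OF _ irrefl],
      assumption, rule wp_Seq, rule wp_tally[where P = ?S])
    fix s r assume s: "env n k A s" "parent_tree n A r (s ''p'')" "child_count n (s ''p'') (s ''c'')"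
      "?S (s ''p'') (s ''c'')" "s ''out'' 0 = 0" "s ''m'' 0 = card {v. v < n \<and> 0 < s ''c'' v}"
    note k = env_k[OF s(1)]
    show "wp (IfNZ (Minus (Var ''k'') (Var ''m'')) emit_decomposition emit_branching)
     (1 + (2 + (2 + (loop_time n (loop_time n 2) + loop_time n (loop_time n 2))))) ?Q s"
    proof (rule wp_If)
      assume "val (Minus (Var ''k'') (Var ''m'')) s \<noteq> 0"
      then have "\<not> k \<le> card {v. v < n \<and> 0 < s ''c'' v}" using k s(6) by simp
      then show "wp emit_decomposition (2 + (2 + (loop_time n (loop_time n 2) + loop_time n (loop_time n 2)))) ?Q s"
        by (intro wp_emit_decomposition[OF s(1) refl refl s(5)]
            exI[of _ r] exI[of _ "s ''p''"] exI[of _ "s ''c''"] conjI s(2-4)) simp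
    next
      assume "val (Minus (Var ''k'') (Var ''m'')) s = 0"
      then have "k \<le> card {v. v < n \<and> 0 < s ''c'' v}" using k s(6) by simp
      then have "wp emit_branching (2 + (2 + loop_time n (loop_time n 2))) ?Q s"
        by (intro wp_emit_branching[OF s(1) refl s(5)]
            exI[of _ r] exI[of _ "s ''p''"] exI[of _ "s ''c''"] conjI s(2-4)) simp
      then show "wp emit_branching (2 + (2 + (loop_time n (loop_time n 2) + loop_time n (loop_time n 2)))) ?Q s"
        by (rule wp_mono) simp_all
    qed
  qed auto
qed auto

section \<open>The polynomial bound and the theorem\<close>

lemma poly_loop_time: "poly (loop_time f g) x = loop_time (poly f x) (poly g x)"
  by (simp add: loop_time_def)

lemma poly_program_time: "poly (program_time f) x = program_time (poly f x)"
  by (simp add: program_time_def search_time_def poly_loop_time)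

lemma poly_nat_mono:
  fixes p :: "nat poly"
  shows "x \<le> y \<Longrightarrow> poly p x \<le> poly p y"
  by (induction p) (auto intro: add_mono mult_mono)

lemma length_le_input_size: "length xs \<le> input_size xs"
  by (induction xs) (auto simp: input_size_def)

lemma encode_digraph_matrix:
  "encode_digraph n G = n # matrix_list n n (\<lambda>u v. of_bool ((u, v) \<in> parcs G))"
  by (simp add: encode_digraph_def matrix_list_def)

theorem theorem3:
  shows "\<exists>(c :: com) (p :: nat poly).
    \<forall>(n :: nat) (D :: nat pair_pre_digraph) (k :: nat).
      digraph (with_proj D) \<and> pverts D = {..<n} \<and> 0 < l_min (with_proj D) \<and> 0 < k \<longrightarrow>
      (\<exists>ys t.
        runs c (k # encode_digraph n D) ys t \<and>
        t \<le> poly p (input_size (k # encode_digraph n D)) \<and>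
        ((\<exists>B :: nat pair_pre_digraph.
            out_branching (with_proj B) (with_proj D) \<and>
            int (card (leaves (with_proj B))) \<le> int n - int k \<and>
            ys = 1 # encode_digraph n B) \<or>
         (\<exists>(m :: nat) (T :: nat pair_pre_digraph) (bag :: nat \<Rightarrow> nat set).
            pverts T = {..<m} \<and>
            digraph_tree_decomposition (with_proj D) (with_proj T) bag \<and>
            width (with_proj T) bag \<le> 2 * int k - 2 \<and>
            ys = 0 # encode_tree_decomposition n m T bag)))"
proof (intro exI[of _ program] exI[of _ "program_time [:0, 1:] + [:2, 0, 2:]"] allI impI)
  fix n :: nat and D :: "nat pair_pre_digraph" and k :: nat
  assume *: "digraph (with_proj D) \<and> pverts D = {..<n} \<and> 0 < l_min (with_proj D) \<and> 0 < k"
  then have D: "digraph (with_proj D)" "pverts D = {..<n}" and "0 < k" by auto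
  interpret D: digraph "with_proj D" by fact
  let ?A = "parcs D" and ?xs = "k # encode_digraph n D"
  have A: "?A \<subseteq> {..<n} \<times> {..<n}" using D.wellformed D(2) by force
  have irrefl: "(v, v) \<notin> ?A" for v using D.no_loops[of "(v, v)"] by auto
  obtain B where "out_branching B (with_proj D)" using * by (auto simp: l_min_def split: if_splits)
  then obtain r where r: "r < n" "\<And>v. v < n \<Longrightarrow> (r, v) \<in> ?A\<^sup>*"
    using out_branching_root_reaches[OF D(1)] D(2) by (metis lessThan_iff)
  have xs: "?xs = k # n # matrix_list n n (\<lambda>u v. of_bool ((u, v) \<in> ?A))"
    by (simp add: encode_digraph_matrix)
  have "wp program (program_time n) (\<lambda>s. \<exists>r p c. parent_tree n ?A r p \<and> child_count n p c \<and>
      (\<forall>a<n. \<forall>b<n. (a, b) \<in> ?A \<longrightarrow> settled p c a b) \<and>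
      (if k \<le> card {v. v < n \<and> 0 < c v}
       then result s = 1 # n # matrix_list n n (\<lambda>u v. of_bool (p v = u))
       else result s = 0 # n # matrix_list n n (\<lambda>u v. of_bool ((u = 0) \<noteq> (v = 0))) @
         matrix_list n n (\<lambda>u v. of_bool (u = v \<or> 0 < c v \<or> c (p v) \<le> 1)))) (initial ?xs)"
    unfolding xs by (rule wp_program[OF irrefl r(1)]) (use r(2) A in \<open>simp add: Int_absorb2\<close>)
  then obtain t s r p c where run: "exec program (initial ?xs) t s" "t \<le> program_time n"
    and t: "parent_tree n ?A r p" and c: "child_count n p c"
    and settled: "\<And>a b. a < n \<Longrightarrow> b < n \<Longrightarrow> (a, b) \<in> ?A \<Longrightarrow> settled p c a b"
    and res: "if k \<le> card {v. v < n \<and> 0 < c v}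
       then result s = 1 # n # matrix_list n n (\<lambda>u v. of_bool (p v = u))
       else result s = 0 # n # matrix_list n n (\<lambda>u v. of_bool ((u = 0) \<noteq> (v = 0))) @
         matrix_list n n (\<lambda>u v. of_bool (u = v \<or> 0 < c v \<or> c (p v) \<le> 1))"
    unfolding wp_def by blast
  let ?I = "{v. v < n \<and> 0 < c v}"
  have runs: "runs program ?xs (result s) (t + length (result s))"
    using run(1) by (auto simp: runs_def)
  \<comment> \<open>The longer output is a tag, \<open>n\<close> and two square matrices, which is
    where \<open>[:2, 0, 2:]\<close> comes from.\<close>
  have "length (result s) \<le> 2 + 2 * (n * n)"
    using res by (auto split: if_splits)
  then have bound: "t + length (result s) \<le> poly (program_time [:0, 1:] + [:2, 0, 2:]) n"
    using run(2) by (simp add: poly_program_time)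
  \<comment> \<open>The bits of the number \<open>n\<close> give only its logarithm; it is the
    adjacency matrix that makes the input size at least \<open>n\<close>.\<close>
  have "n \<le> 2 + n * n" by (cases n) auto
  then have "n \<le> length ?xs" by (simp add: xs)
  then have "n \<le> input_size ?xs" using length_le_input_size le_trans by blast
  then have "poly (program_time [:0, 1:] + [:2, 0, 2:]) n
      \<le> poly (program_time [:0, 1:] + [:2, 0, 2:]) (input_size ?xs)"
    by (rule poly_nat_mono)
  with bound have time: "t + length (result s) \<le> poly (program_time [:0, 1:] + [:2, 0, 2:]) (input_size ?xs)"
    by (rule le_trans)
  obtain h where rn: "r < n" "p r = n" and h: "\<And>v. v < n \<Longrightarrow> v \<noteq> r \<Longrightarrow>
      p v < n \<and> (p v, v) \<in> ?A \<and> h (p v) < (h v :: nat)"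
    using t by (auto simp: parent_tree_def)
  show "\<exists>ys t. runs program ?xs ys t \<and>
        t \<le> poly (program_time [:0, 1:] + [:2, 0, 2:]) (input_size ?xs) \<and>
        ((\<exists>B :: nat pair_pre_digraph.
            out_branching (with_proj B) (with_proj D) \<and>
            int (card (leaves (with_proj B))) \<le> int n - int k \<and>
            ys = 1 # encode_digraph n B) \<or>
         (\<exists>(m :: nat) (T :: nat pair_pre_digraph) (bag :: nat \<Rightarrow> nat set).
            pverts T = {..<m} \<and>
            digraph_tree_decomposition (with_proj D) (with_proj T) bag \<and>
            width (with_proj T) bag \<le> 2 * int k - 2 \<and>
            ys = 0 # encode_tree_decomposition n m T bag))"
  proof (intro exI conjI, rule runs, rule time, cases "k \<le> card ?I")
    case True
    let ?B = "\<lparr>pverts = {..<n}, parcs = parent_arcs {..<n} r p\<rparr>"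
    have "out_branching (with_proj ?B) (with_proj D)"
      by (rule out_branching_parent_arcs[OF D, of r p h]) (use rn h in auto)
    moreover have "int (card (leaves (with_proj ?B))) \<le> int n - int k"
      using True card_leaves_parent_arcs[OF t c] by simp
    \<comment> \<open>No \<open>u < n\<close> equals the marker \<open>p r = n\<close>, so the
      column of the root is zero without a separate test.\<close>
    moreover have "(u, v) \<in> parent_arcs {..<n} r p \<longleftrightarrow> p v = u" if "u < n" "v < n" for u v
      using that rn by (auto simp: parent_arcs_def)
    then have "matrix_list n n (\<lambda>u v. of_bool (p v = u) :: nat)
        = matrix_list n n (\<lambda>u v. of_bool ((u, v) \<in> parent_arcs {..<n} r p))"
      by (intro matrix_list_cong) simp
    then have "result s = 1 # encode_digraph n ?B"
      using res True by (simp add: encode_digraph_matrix)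
    ultimately show "(\<exists>B :: nat pair_pre_digraph.
            out_branching (with_proj B) (with_proj D) \<and>
            int (card (leaves (with_proj B))) \<le> int n - int k \<and>
            result s = 1 # encode_digraph n B) \<or>
         (\<exists>(m :: nat) (T :: nat pair_pre_digraph) (bag :: nat \<Rightarrow> nat set).
            pverts T = {..<m} \<and>
            digraph_tree_decomposition (with_proj D) (with_proj T) bag \<and>
            width (with_proj T) bag \<le> 2 * int k - 2 \<and>
            result s = 0 # encode_tree_decomposition n m T bag)" by blast
  next
    case False
    let ?T = "\<lparr>pverts = {..<n}, parcs = {(i, j). i < n \<and> j < n \<and> (i = 0) \<noteq> (j = 0)}\<rparr>"
    let ?C = "?I \<union> {v. v < n \<and> c (p v) \<le> 1}"
    \<comment> \<open>If both ends are leaves, \<open>settled\<close> makes \<open>b\<close> an only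
      child, so \<open>b\<close> itself is in the cover.\<close>
    have "a \<in> ?C \<or> b \<in> ?C" if "(a, b) \<in> ?A" for a b
      using settled[of a b] that A by (auto simp: settled_def)
    then have "digraph_tree_decomposition (with_proj D) (with_proj ?T) (\<lambda>t. insert t ?C)"
      using rn(1) by (intro star_tree_decomposition[OF D]) auto
    \<comment> \<open>Here \<open>card ?I \<le> k - 1\<close>, and
      \<open>2 * (k - 1) + 1 = 2 * k - 1\<close>; \<open>width\<close> subtracts the last 1.\<close>
    moreover have "card (insert x ?C) \<le> 2 * k - 1" if "x < n" for x
      using card_cover[OF t c that] False \<open>0 < k\<close> by simp
    then have "Max ((\<lambda>t. card (insert t ?C)) ` {..<n}) \<le> 2 * k - 1"
      using rn(1) by (subst Max_le_iff) (auto simp: lessThan_empty_iff)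
    then have "width (with_proj ?T) (\<lambda>t. insert t ?C) \<le> 2 * int k - 2"
      using \<open>0 < k\<close> by (simp add: width_def)
    moreover have "result s = 0 # encode_tree_decomposition n n ?T (\<lambda>t. insert t ?C)"
    proof -
      have "matrix_list n n (\<lambda>u v. of_bool (u = v \<or> 0 < c v \<or> c (p v) \<le> 1) :: nat)
          = matrix_list n n (\<lambda>u v. of_bool (v \<in> insert u ?C))"
        by (intro matrix_list_cong) auto
      moreover have "matrix_list n n (\<lambda>u v. of_bool ((u = 0) \<noteq> (v = 0)) :: nat)
          = matrix_list n n (\<lambda>u v. of_bool ((u, v) \<in> parcs ?T))"
        by (intro matrix_list_cong) auto
      ultimately show ?thesis
        using res False
        by (simp add: encode_tree_decomposition_def encode_digraph_matrix flip: matrix_list_def)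
    qed
    ultimately show "(\<exists>B :: nat pair_pre_digraph.
            out_branching (with_proj B) (with_proj D) \<and>
            int (card (leaves (with_proj B))) \<le> int n - int k \<and>
            result s = 1 # encode_digraph n B) \<or>
         (\<exists>(m :: nat) (T :: nat pair_pre_digraph) (bag :: nat \<Rightarrow> nat set).
            pverts T = {..<m} \<and>
            digraph_tree_decomposition (with_proj D) (with_proj T) bag \<and>
            width (with_proj T) bag \<le> 2 * int k - 2 \<and>
            result s = 0 # encode_tree_decomposition n m T bag)"
      by (metis (no_types, lifting) pair_pre_digraph.select_convs(1))
  qed
qed

end
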